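(* Consider a network of $N$ parallel roads with mixed human-driven and autonomous traffic and flow demand $(\bar{x},\bar{y})$, all vehicles being selfish. Consider the two-stage optimization problem: first find $$m^*_{\mathrm{EQ}}=\operatorname*{arg\,min}_{m\in[N]} a_{m}\quad\text{s.t.}\quad \mathrm{NE}(\bar{x},\bar{y},m)\neq\emptyset ,$$ and then find an element of $$\operatorname*{arg\,max}_{(\boldsymbol{x},\boldsymbol{y},\boldsymbol{s})\in \mathrm{NE}(\bar{x},\bar{y},m^*_{\mathrm{EQ}})}\ \beta(\boldsymbol{x},\boldsymbol{y},\bar{x},\bar{y},s_{m^*_{\mathrm{EQ}}}) .$$ Finding a solution to this problem is equivalent to finding a routing in the set RBNE of Robust Best Nash Equilibria, if any exist. Further, this problem can be solved in $O(N^4)$ time.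
   Context: Network model. There are $N$ parallel roads (same origin and destination), indexed by $[N]=\{1,\dots,N\}$. Road $i$ has length $d_i>0$, free-flow speed $v^f_i>0$, maximum density $\rho^{\max}_i$, and nominal headways $\bar{h}_i\le h_i$ for autonomous and human-driven vehicles respectively; all vehicles have length $L>0$. Let $x_i,y_i\ge 0$ be the human-driven and autonomous flow on road $i$. The critical density is $$\rho^{\mathrm{crit}}_i(x_i,y_i)=\left(\frac{y_i}{x_i+y_i}\bar{h}_i+\frac{x_i}{x_i+y_i}h_i+L\right)^{-1},$$ with $\rho^{\mathrm{crit}}_i<\rho^{\max}_i$ always, and the maximum flow is $z^{\max}_i(x_i,y_i)=v^f_i\,\rho^{\mathrm{crit}}_i(x_i,y_i)$. The state $s_i\in\{0,1\}$ says whether road $i$ is in free-flow ($s_i=0$) or congested ($s_i=1$). The latency is $$\ell_i(x_i,y_i,s_i)=\begin{cases} d_i/v^f_i, & s_i=0,\\ d_i\left(\dfrac{\rho^{\max}_i}{x_i+y_i}+\dfrac{\rho^{\mathrm{crit}}_i(x_i,y_i)-\rho^{\max}_i}{z^{\max}_i(x_i,y_i)}\right), & s_i=1.\end{cases}$$ The free-flow latency is $a_i=d_i/v^f_i$; no two roads have equal free-flow latencies and roads are ordered so that $a_1<a_2<\dots<a_N$. A road with zero flow is in free-flow (latency $a_i$), and a road carrying exactly its maximum flow (where both formulas give $a_i$) is regarded as in free-flow. Routings. The demand $(\bar{x},\bar{y})$, $\bar{x},\bar{y}\ge 0$, is inelastic. A feasible routing of the demand is a triple $(\boldsymbol{x},\boldsymbol{y},\boldsymbol{s})\in\mathbb{R}^N_{\ge0}\times\mathbb{R}^N_{\ge0}\times\{0,1\}^N$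 with $\sum_i x_i=\bar{x}$, $\sum_i y_i=\bar{y}$ and $x_i+y_i\le z^{\max}_i(x_i,y_i)$ on every road (trivially satisfied if $x_i+y_i=0$). Its total latency is $C(\boldsymbol{x},\boldsymbol{y},\boldsymbol{s})=\sum_{i\in[N]}(x_i+y_i)\ell_i(x_i,y_i,s_i)$. Nash equilibrium. A feasible routing is a Nash (Wardrop) Equilibrium if no vehicle can lower its travel time by unilaterally switching routes: $x_i+y_i>0$ implies $\ell_i(x_i,y_i,s_i)\le \ell_j(x_j,y_j,s_j)$ for all $j\in[N]$. Its longest equilibrium road is the road with maximum free-flow latency whose delay equals the (common) delay experienced by the selfish users. $\mathrm{NE}(\bar{x},\bar{y},m)$ is the set of Nash Equilibria for demand $(\bar{x},\bar{y})$ whose longest equilibrium road has index $m$. BNE is the set of Nash Equilibria for the demand that minimize $C$ among all Nash Equilibria for that demand. Robustness. For a routing in $\mathrm{NE}(\bar{x},\bar{y},m)$, its robustness $\beta(\boldsymbol{x},\boldsymbol{y},\bar{x},\bar{y},s_m)$ is $0$ if $s_m=1$, and if $s_m=0$ it is the maximum $\gamma$ such that $$x_m+y_m+\gamma(\bar{x}+\bar{y})\le z^{\max}_m(x_m+\gamma\bar{x},\,y_m+\gamma\bar{y}).$$ RBNE is the subset of BNE consisting of routings that maximize robustness (the robustness of a routing in BNE being taken at its longest equilibrium road). Complexity. Running time is measured as a function of the number of roads $N$, using that a linear program with $O(N)$ variables and constraints is solved in $O(N^3)$ time. *)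

theory Defs
  imports Complex_Main "HOL-Library.Landau_Symbols"
begin

section \<open>Parallel networks with mixed traffic\<close>

text \<open>
  Roads are indexed by \<open>{1..roads G}\<close>; the values of all road-indexed functions outside this
  range are irrelevant. \<open>hw_av\<close> and \<open>hw_hv\<close> are the nominal headways of autonomous and
  human-driven vehicles.
\<close>

record network =
  roads :: nat
  len :: "nat \<Rightarrow> real"
  vfree :: "nat \<Rightarrow> real"
  rho_max :: "nat \<Rightarrow> real"
  hw_av :: "nat \<Rightarrow> real"
  hw_hv :: "nat \<Rightarrow> real"
  veh_len :: real

text \<open>
  In \<open>rho_crit\<close>, \<open>x\<close> is the human-driven and \<open>y\<close> the autonomous flow. At \<open>x + y = 0\<close> the
  convention \<open>0 / 0 = 0\<close> gives the harmless value \<open>1 / veh_len G > 0\<close>.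
\<close>

definition rho_crit :: "network \<Rightarrow> nat \<Rightarrow> real \<Rightarrow> real \<Rightarrow> real" where
  "rho_crit G i x y =
     inverse (y / (x + y) * hw_av G i + x / (x + y) * hw_hv G i + veh_len G)"

definition max_flow :: "network \<Rightarrow> nat \<Rightarrow> real \<Rightarrow> real \<Rightarrow> real" where
  "max_flow G i x y = vfree G i * rho_crit G i x y"

definition free_latency :: "network \<Rightarrow> nat \<Rightarrow> real" where
  "free_latency G i = len G i / vfree G i"

text \<open>The state of a road is \<open>True\<close> if the road is congested and \<open>False\<close> if it is in free-flow.\<close>

definition latency :: "network \<Rightarrow> nat \<Rightarrow> real \<Rightarrow> real \<Rightarrow> bool \<Rightarrow> real" where
  "latency G i x y s =
     (if s then len G i * (rho_max G i / (x + y)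
                           + (rho_crit G i x y - rho_max G i) / max_flow G i x y)
      else len G i / vfree G i)"

text \<open>
  Positivity of the critical density expresses that it is a meaningful density; it holds
  automatically for nonnegative headways.
\<close>

definition valid_network :: "network \<Rightarrow> bool" where
  "valid_network G \<longleftrightarrow>
     veh_len G > 0 \<and>
     (\<forall>i\<in>{1..roads G}.
        len G i > 0 \<and> vfree G i > 0 \<and> hw_av G i \<le> hw_hv G i \<and>
        (\<forall>x y. x \<ge> 0 \<and> y \<ge> 0 \<and> x + y > 0 \<longrightarrow>
           0 < rho_crit G i x y \<and> rho_crit G i x y < rho_max G i)) \<and>
     strict_mono_on {1..roads G} (free_latency G)"

section \<open>Routings and equilibria\<close>

type_synonym routing = "(nat \<Rightarrow> real) \<times> (nat \<Rightarrow> real) \<times> (nat \<Rightarrow> bool)"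

text \<open>
  The last condition encodes the conventions that an empty road and a road carrying exactly its
  maximum flow are in free-flow.
\<close>

definition feasible ::
  "network \<Rightarrow> real \<Rightarrow> real \<Rightarrow> (nat \<Rightarrow> real) \<Rightarrow> (nat \<Rightarrow> real) \<Rightarrow> (nat \<Rightarrow> bool) \<Rightarrow> bool" where
  "feasible G xb yb x y s \<longleftrightarrow>
     (\<Sum>i\<in>{1..roads G}. x i) = xb \<and> (\<Sum>i\<in>{1..roads G}. y i) = yb \<and>
     (\<forall>i\<in>{1..roads G}.
        x i \<ge> 0 \<and> y i \<ge> 0 \<and> x i + y i \<le> max_flow G i (x i) (y i) \<and>
        (s i \<longrightarrow> 0 < x i + y i \<and> x i + y i < max_flow G i (x i) (y i)))"

definition total_latency :: "network \<Rightarrow> routing \<Rightarrow> real" where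
  "total_latency G = (\<lambda>(x, y, s).
     \<Sum>i\<in>{1..roads G}. (x i + y i) * latency G i (x i) (y i) (s i))"

definition nash ::
  "network \<Rightarrow> real \<Rightarrow> real \<Rightarrow> (nat \<Rightarrow> real) \<Rightarrow> (nat \<Rightarrow> real) \<Rightarrow> (nat \<Rightarrow> bool) \<Rightarrow> bool" where
  "nash G xb yb x y s \<longleftrightarrow>
     feasible G xb yb x y s \<and>
     (\<forall>i\<in>{1..roads G}. x i + y i > 0 \<longrightarrow>
        (\<forall>j\<in>{1..roads G}. latency G i (x i) (y i) (s i) \<le> latency G j (x j) (y j) (s j)))"

text \<open>
  \<open>D\<close> is the common delay of all users. There must be a user at all, so that with zero demand
  there is no common delay, hence no longest equilibrium road.
\<close>

definition common_delay ::
  "network \<Rightarrow> (nat \<Rightarrow> real) \<Rightarrow> (nat \<Rightarrow> real) \<Rightarrow> (nat \<Rightarrow> bool) \<Rightarrow> real \<Rightarrow> bool" where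
  "common_delay G x y s D \<longleftrightarrow>
     (\<exists>i\<in>{1..roads G}. x i + y i > 0) \<and>
     (\<forall>i\<in>{1..roads G}. x i + y i > 0 \<longrightarrow> latency G i (x i) (y i) (s i) = D)"

definition longest_road ::
  "network \<Rightarrow> (nat \<Rightarrow> real) \<Rightarrow> (nat \<Rightarrow> real) \<Rightarrow> (nat \<Rightarrow> bool) \<Rightarrow> nat \<Rightarrow> bool" where
  "longest_road G x y s m \<longleftrightarrow>
     (\<exists>D. common_delay G x y s D \<and>
          is_arg_max (free_latency G)
            (\<lambda>j. j \<in> {1..roads G} \<and> latency G j (x j) (y j) (s j) = D) m)"

definition NE :: "network \<Rightarrow> real \<Rightarrow> real \<Rightarrow> nat \<Rightarrow> routing set" where
  "NE G xb yb m = {(x, y, s). nash G xb yb x y s \<and> longest_road G x y s m}"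

definition BNE :: "network \<Rightarrow> real \<Rightarrow> real \<Rightarrow> routing set" where
  "BNE G xb yb = {r. is_arg_min (total_latency G) (\<lambda>(x, y, s). nash G xb yb x y s) r}"

definition robustness :: "network \<Rightarrow> real \<Rightarrow> real \<Rightarrow> nat \<Rightarrow> routing \<Rightarrow> real" where
  "robustness G xb yb m = (\<lambda>(x, y, s).
     if s m then 0
     else (GREATEST \<gamma>. x m + y m + \<gamma> * (xb + yb)
                         \<le> max_flow G m (x m + \<gamma> * xb) (y m + \<gamma> * yb)))"

text \<open>The robustness of each best equilibrium is taken at its own longest equilibrium road.\<close>

definition RBNE :: "network \<Rightarrow> real \<Rightarrow> real \<Rightarrow> routing set" where
  "RBNE G xb yb =
     {r \<in> BNE G xb yb. \<exists>m. r \<in> NE G xb yb m \<and>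
        (\<forall>r'\<in>BNE G xb yb. \<forall>m'. r' \<in> NE G xb yb m' \<longrightarrow>
           robustness G xb yb m' r' \<le> robustness G xb yb m r)}"

definition m_EQ :: "network \<Rightarrow> real \<Rightarrow> real \<Rightarrow> nat \<Rightarrow> bool" where
  "m_EQ G xb yb m \<longleftrightarrow>
     is_arg_min (free_latency G) (\<lambda>m. m \<in> {1..roads G} \<and> NE G xb yb m \<noteq> {}) m"

definition two_stage :: "network \<Rightarrow> real \<Rightarrow> real \<Rightarrow> routing set" where
  "two_stage G xb yb =
     {r. \<exists>m. m_EQ G xb yb m \<and>
             is_arg_max (robustness G xb yb m) (\<lambda>r. r \<in> NE G xb yb m) r}"

section \<open>Linear programs\<close>

text \<open>
  Maximize \<open>\<Sum>j<n. c j * z j\<close> over all real \<open>z\<close> subject to the \<open>k\<close> constraints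
  \<open>(\<Sum>j<n. A i j * z j) \<le> b i\<close>; only entries with \<open>i < k\<close> and \<open>j < n\<close> matter.
\<close>

definition lp_feasible ::
  "nat \<Rightarrow> nat \<Rightarrow> (nat \<Rightarrow> nat \<Rightarrow> real) \<Rightarrow> (nat \<Rightarrow> real) \<Rightarrow> (nat \<Rightarrow> real) \<Rightarrow> bool" where
  "lp_feasible n k A b z \<longleftrightarrow> (\<forall>i<k. (\<Sum>j<n. A i j * z j) \<le> b i)"

definition lp_optimal ::
  "nat \<Rightarrow> nat \<Rightarrow> (nat \<Rightarrow> nat \<Rightarrow> real) \<Rightarrow> (nat \<Rightarrow> real) \<Rightarrow> (nat \<Rightarrow> real) \<Rightarrow> (nat \<Rightarrow> real) \<Rightarrow> bool" where
  "lp_optimal n k A b c z \<longleftrightarrow> is_arg_max (\<lambda>z. \<Sum>j<n. c j * z j) (lp_feasible n k A b) z"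

type_synonym lp_solver =
  "nat \<Rightarrow> nat \<Rightarrow> (nat \<Rightarrow> nat \<Rightarrow> real) \<Rightarrow> (nat \<Rightarrow> real) \<Rightarrow> (nat \<Rightarrow> real) \<Rightarrow> (nat \<Rightarrow> real) option"

definition correct_lp_solver :: "lp_solver \<Rightarrow> bool" where
  "correct_lp_solver solve \<longleftrightarrow>
     (\<forall>n k A b c. case solve n k A b c of
        None \<Rightarrow> \<not> (\<exists>z. lp_optimal n k A b c z)
      | Some z \<Rightarrow> lp_optimal n k A b c z)"

section \<open>Machine model\<close>

text \<open>
  A real-RAM with an additional instruction that solves a linear program. The memory consists of
  finitely many (per program) natural-number registers, used for indexing, and real arrays with
  two indices; vectors and scalars occupy the cells \<open>(i, 0)\<close> and \<open>(0, 0)\<close>. Programs contain no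
  real constants other than integers, so no information can be hidden in them. One program has to
  work for all numbers of roads.
\<close>

type_synonym vname = string

record store =
  nats :: "vname \<Rightarrow> nat"
  reals :: "vname \<Rightarrow> nat \<Rightarrow> nat \<Rightarrow> real"

datatype nexp = NConst nat | NVar vname | NAdd nexp nexp | NSub nexp nexp

datatype rexp =
    RConst int
  | RCell vname nexp nexp
  | RAdd rexp rexp | RSub rexp rexp | RMul rexp rexp | RDiv rexp rexp

datatype test = NLess nexp nexp | RLess rexp rexp | TNot test | TAnd test test

text \<open>
  The arguments of \<open>SolveLP\<close> are the numbers of variables and of constraints, the arrays holding
  matrix, right-hand side and objective, the array that receives the solution, and the natural
  number register that receives 1 if a solution was found and 0 otherwise.
\<close>

datatype com =
    Skip
  | NAssign vname nexp
  | RAssign vname nexp nexp rexp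
  | Seq com com
  | Cond test com com
  | While test com
  | SolveLP nexp nexp vname vname vname vname vname

fun nval :: "store \<Rightarrow> nexp \<Rightarrow> nat" where
  "nval \<sigma> (NConst k) = k"
| "nval \<sigma> (NVar v) = nats \<sigma> v"
| "nval \<sigma> (NAdd e f) = nval \<sigma> e + nval \<sigma> f"
| "nval \<sigma> (NSub e f) = nval \<sigma> e - nval \<sigma> f"

fun rval :: "store \<Rightarrow> rexp \<Rightarrow> real" where
  "rval \<sigma> (RConst k) = of_int k"
| "rval \<sigma> (RCell v i j) = reals \<sigma> v (nval \<sigma> i) (nval \<sigma> j)"
| "rval \<sigma> (RAdd e f) = rval \<sigma> e + rval \<sigma> f"
| "rval \<sigma> (RSub e f) = rval \<sigma> e - rval \<sigma> f"
| "rval \<sigma> (RMul e f) = rval \<sigma> e * rval \<sigma> f"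
| "rval \<sigma> (RDiv e f) = rval \<sigma> e / rval \<sigma> f"

fun tval :: "store \<Rightarrow> test \<Rightarrow> bool" where
  "tval \<sigma> (NLess e f) \<longleftrightarrow> nval \<sigma> e < nval \<sigma> f"
| "tval \<sigma> (RLess e f) \<longleftrightarrow> rval \<sigma> e < rval \<sigma> f"
| "tval \<sigma> (TNot t) \<longleftrightarrow> \<not> tval \<sigma> t"
| "tval \<sigma> (TAnd t u) \<longleftrightarrow> tval \<sigma> t \<and> tval \<sigma> u"

definition set_nat :: "vname \<Rightarrow> nat \<Rightarrow> store \<Rightarrow> store" where
  "set_nat v k \<sigma> = \<sigma>\<lparr>nats := (nats \<sigma>)(v := k)\<rparr>"

definition set_cell :: "vname \<Rightarrow> nat \<Rightarrow> nat \<Rightarrow> real \<Rightarrow> store \<Rightarrow> store" where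
  "set_cell v i j a \<sigma> =
     \<sigma>\<lparr>reals := (reals \<sigma>)(v := (reals \<sigma> v)(i := (reals \<sigma> v i)(j := a)))\<rparr>"

definition set_vector :: "vname \<Rightarrow> nat \<Rightarrow> (nat \<Rightarrow> real) \<Rightarrow> store \<Rightarrow> store" where
  "set_vector v n z \<sigma> =
     \<sigma>\<lparr>reals := (reals \<sigma>)
         (v := (\<lambda>i j. if i < n \<and> j = 0 then z i else reals \<sigma> v i j))\<rparr>"

definition lp_step ::
  "lp_solver \<Rightarrow> nat \<Rightarrow> nat \<Rightarrow> vname \<Rightarrow> vname \<Rightarrow> vname \<Rightarrow> vname \<Rightarrow> vname \<Rightarrow> store \<Rightarrow> store" where
  "lp_step solve n k A b c z flag \<sigma> =
     (case solve n k (reals \<sigma> A) (\<lambda>i. reals \<sigma> b i 0) (\<lambda>j. reals \<sigma> c j 0) of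
        None \<Rightarrow> set_nat flag 0 \<sigma>
      | Some w \<Rightarrow> set_nat flag 1 (set_vector z n w \<sigma>))"

text \<open>
  \<open>exec solve p \<sigma> t \<tau>\<close>: program \<open>p\<close> started in \<open>\<sigma>\<close> terminates in \<open>\<tau>\<close> after time \<open>t\<close>.
  Assignments and tests take unit time, since their expressions are part of the program and thus
  of constant size. A linear program is charged the cube of its number of variables plus
  constraints, i.e. cubic time if both numbers are linear in the number of roads.
\<close>

inductive exec :: "lp_solver \<Rightarrow> com \<Rightarrow> store \<Rightarrow> nat \<Rightarrow> store \<Rightarrow> bool" for solve where
  Skip: "exec solve Skip \<sigma> 1 \<sigma>"
| NAssign: "exec solve (NAssign v e) \<sigma> 1 (set_nat v (nval \<sigma> e) \<sigma>)"
| RAssign: "exec solve (RAssign v i j e) \<sigma> 1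
              (set_cell v (nval \<sigma> i) (nval \<sigma> j) (rval \<sigma> e) \<sigma>)"
| Seq: "exec solve p \<sigma> t1 \<sigma>' \<Longrightarrow> exec solve q \<sigma>' t2 \<tau> \<Longrightarrow> exec solve (Seq p q) \<sigma> (t1 + t2) \<tau>"
| CondTrue: "tval \<sigma> b \<Longrightarrow> exec solve p \<sigma> t \<tau> \<Longrightarrow> exec solve (Cond b p q) \<sigma> (1 + t) \<tau>"
| CondFalse: "\<not> tval \<sigma> b \<Longrightarrow> exec solve q \<sigma> t \<tau> \<Longrightarrow> exec solve (Cond b p q) \<sigma> (1 + t) \<tau>"
| WhileFalse: "\<not> tval \<sigma> b \<Longrightarrow> exec solve (While b p) \<sigma> 1 \<sigma>"
| WhileTrue: "tval \<sigma> b \<Longrightarrow> exec solve p \<sigma> t1 \<sigma>' \<Longrightarrow> exec solve (While b p) \<sigma>' t2 \<tau> \<Longrightarrow>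
    exec solve (While b p) \<sigma> (1 + t1 + t2) \<tau>"
| SolveLP: "exec solve (SolveLP en ek A b c z flag) \<sigma> (1 + (nval \<sigma> en + nval \<sigma> ek) ^ 3)
              (lp_step solve (nval \<sigma> en) (nval \<sigma> ek) A b c z flag \<sigma>)"

inductive_cases exec_SkipE: "exec solve Skip \<sigma> t \<tau>"
inductive_cases exec_NAssignE: "exec solve (NAssign v e) \<sigma> t \<tau>"
inductive_cases exec_RAssignE: "exec solve (RAssign v i j e) \<sigma> t \<tau>"
inductive_cases exec_SeqE: "exec solve (Seq p q) \<sigma> t \<tau>"
inductive_cases exec_SolveLPE: "exec solve (SolveLP en ek A b c z flag) \<sigma> t \<tau>"

lemma exec_deterministic:
  assumes "exec solve p \<sigma> t \<tau>" and "exec solve p \<sigma> t' \<tau>'"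
  shows "t = t' \<and> \<tau> = \<tau>'"
  using assms
proof (induction arbitrary: t' \<tau>')
  case (Skip \<sigma>)
  then show ?case by (rule exec_SkipE) simp
next
  case (NAssign v e \<sigma>)
  then show ?case by (rule exec_NAssignE) simp
next
  case (RAssign v i j e \<sigma>)
  then show ?case by (rule exec_RAssignE) simp
next
  case (Seq p \<sigma> t1 \<sigma>' q t2 \<tau>)
  from Seq.prems obtain u1 \<rho> u2
    where "exec solve p \<sigma> u1 \<rho>" and q: "exec solve q \<rho> u2 \<tau>'" and t': "t' = u1 + u2"
    by (rule exec_SeqE)
  from Seq.IH(1)[OF this(1)] Seq.IH(2) q t' show ?case by metis
next
  case (CondTrue \<sigma> b p t \<tau> q)
  from CondTrue.prems CondTrue.hyps(1) obtain u where "exec solve p \<sigma> u \<tau>'" and t': "t' = 1 + u"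
    by (cases rule: exec.cases) simp_all
  from CondTrue.IH[OF this(1)] t' show ?case by simp
next
  case (CondFalse \<sigma> b q t \<tau> p)
  from CondFalse.prems CondFalse.hyps(1) obtain u where "exec solve q \<sigma> u \<tau>'" and t': "t' = 1 + u"
    by (cases rule: exec.cases) simp_all
  from CondFalse.IH[OF this(1)] t' show ?case by simp
next
  case (WhileFalse \<sigma> b p)
  from WhileFalse.prems WhileFalse.hyps(1) show ?case
    by (cases rule: exec.cases) simp_all
next
  case (WhileTrue \<sigma> b p t1 \<sigma>' t2 \<tau>)
  from WhileTrue.prems WhileTrue.hyps(1) obtain u1 \<rho> u2
    where "exec solve p \<sigma> u1 \<rho>" and q: "exec solve (While b p) \<rho> u2 \<tau>'"
      and t': "t' = 1 + u1 + u2"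
    by (cases rule: exec.cases) simp_all
  from WhileTrue.IH(1)[OF this(1)] WhileTrue.IH(2) q t' show ?case by metis
next
  case (SolveLP en \<sigma> ek A b c z flag)
  then show ?case by (rule exec_SolveLPE) simp
qed

section \<open>The two-stage problem as a computational problem\<close>

definition input_store :: "network \<Rightarrow> real \<Rightarrow> real \<Rightarrow> store \<Rightarrow> bool" where
  "input_store G xb yb \<sigma> \<longleftrightarrow>
     nats \<sigma> ''N'' = roads G \<and>
     (\<forall>i\<in>{1..roads G}.
        reals \<sigma> ''d'' i 0 = len G i \<and>
        reals \<sigma> ''vf'' i 0 = vfree G i \<and>
        reals \<sigma> ''rhomax'' i 0 = rho_max G i \<and>
        reals \<sigma> ''hav'' i 0 = hw_av G i \<and>
        reals \<sigma> ''hhv'' i 0 = hw_hv G i) \<and>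
     reals \<sigma> ''L'' 0 0 = veh_len G \<and>
     reals \<sigma> ''xbar'' 0 0 = xb \<and>
     reals \<sigma> ''ybar'' 0 0 = yb"

text \<open>
  The output is the index found in the first stage in register \<open>m\<close> and the routing found in the
  second stage in the arrays \<open>x\<close>, \<open>y\<close>, \<open>s\<close>, or 0 in register \<open>m\<close> if the problem has no
  solution.
\<close>

definition output_store :: "network \<Rightarrow> real \<Rightarrow> real \<Rightarrow> store \<Rightarrow> bool" where
  "output_store G xb yb \<tau> \<longleftrightarrow>
     (if two_stage G xb yb = {} then nats \<tau> ''m'' = 0
      else m_EQ G xb yb (nats \<tau> ''m'') \<and>
           (\<exists>s. (\<forall>i\<in>{1..roads G}. reals \<tau> ''s'' i 0 = of_bool (s i)) \<and>
                is_arg_max (robustness G xb yb (nats \<tau> ''m''))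
                  (\<lambda>r. r \<in> NE G xb yb (nats \<tau> ''m''))
                  (\<lambda>i. reals \<tau> ''x'' i 0, \<lambda>i. reals \<tau> ''y'' i 0, s)))"

end

theory Submission
  imports Defs "HOL-Analysis.Function_Topology" "HOL-Real_Asymp.Real_Asymp"
begin

text \<open>
  The total latency of an equilibrium is its common delay \<open>D\<close> times the demand, so everything
  depends on which delays occur. Two observations answer this.

  First, although latencies are rational functions of the flows, the equilibrium conditions for a
  fixed \<open>D\<close> are linear (\<open>congested_latency_eq_iff\<close>). Assign to a flow on road \<open>i\<close> its
  load \<open>load G D i\<close>, a linear function. Congested flow has latency \<open>D\<close> iff its load is \<open>1\<close>, and flow
  respects the capacity iff its load at the free-flow latency is at most \<open>1\<close>. An equilibrium with
  delay \<open>D\<close> is a routing with load \<open>1\<close> on all roads faster than \<open>D\<close>, load at most \<open>1\<close> on a road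
  whose free-flow latency is \<open>D\<close>, and no flow on slower roads.

  Second, a delay can be lowered. Loads increase with \<open>D\<close>, so from an equilibrium with longest road
  \<open>m\<close> and any delay one obtains a routing on the roads up to \<open>m\<close> whose loads at the delay
  \<open>free_latency G m\<close> are at most \<open>1\<close>. Filling the earlier roads one after the other with
  flow taken from road \<open>m\<close> yields an equilibrium with delay \<open>free_latency G m\<close>, unless road \<open>m\<close>
  runs empty and the argument continues with \<open>m - 1\<close> (\<open>packing_dichotomy\<close>). Thus for the
  least possible \<open>m\<close> there are equilibria with delay \<open>free_latency G m\<close>, and they are the best
  equilibria (\<open>BNE_iff\<close>). Other equilibria with longest road \<open>m\<close> have a larger delay, so
  road \<open>m\<close> is congested and their robustness is \<open>0\<close>. If there are any, filling leaves spare capacity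
  on road \<open>m\<close>, so they do not maximize the robustness (\<open>congested_NE_imp_robust_equil\<close>). This
  proves that the two-stage problem has the robust best equilibria as its solutions.

  For the running time, the equilibria with delay \<open>free_latency G m\<close> are the feasible
  points of a linear program with \<open>2 N\<close> variables and \<open>4 N + 4\<close> constraints, and the robustness is a
  decreasing affine function of the load of road \<open>m\<close> (\<open>equil_lp_feasible_iff\<close>, \<open>robustness_eq\<close>).
  The program solves these linear programs for \<open>m = 1, 2, \<dots>\<close> until one is feasible: at most \<open>N\<close>
  calls of cubic cost.
\<close>

(* Roads are counted from 1, so the numeral has to survive simplification. *)
declare One_nat_def [simp del]

section \<open>The load of a road\<close>

text \<open>
  The share of the capacity of road \<open>i\<close> taken by one unit of human-driven flow when every user of
  the road experiences delay \<open>D\<close>. The first summand is the time for which a vehicle occupies a point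
  of the road in free flow; the second one accounts for congestion. The cut-off
  at \<open>0\<close> concerns roads whose free-flow latency exceeds \<open>D\<close>: it keeps the share positive and
  monotone in \<open>D\<close>.
\<close>

definition human_load :: "network \<Rightarrow> real \<Rightarrow> nat \<Rightarrow> real" where
  "human_load G D i = (hw_hv G i + veh_len G) / vfree G i
     + max 0 (D - free_latency G i) / (len G i * rho_max G i)"

definition av_load :: "network \<Rightarrow> real \<Rightarrow> nat \<Rightarrow> real" where
  "av_load G D i = (hw_av G i + veh_len G) / vfree G i
     + max 0 (D - free_latency G i) / (len G i * rho_max G i)"

definition load :: "network \<Rightarrow> real \<Rightarrow> nat \<Rightarrow> real \<Rightarrow> real \<Rightarrow> real" where
  "load G D i x y = human_load G D i * x + av_load G D i * y"

context
  fixes G :: network and i :: nat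
  assumes valid: "valid_network G" and road: "i \<in> {1..roads G}"
begin

lemma road_params_pos:
  "len G i > 0" "vfree G i > 0" "hw_av G i + veh_len G > 0" "hw_hv G i + veh_len G > 0"
  "rho_max G i > 0"
proof -
  have crit: "0 < rho_crit G i x y \<and> rho_crit G i x y < rho_max G i"
    if "x \<ge> 0" "y \<ge> 0" "x + y > 0" for x y
    using valid road that unfolding valid_network_def by blast
  show "len G i > 0" "vfree G i > 0"
    using valid road unfolding valid_network_def by blast+
  show "hw_av G i + veh_len G > 0" "hw_hv G i + veh_len G > 0"
    using crit[of 0 1] crit[of 1 0] by (auto simp: rho_crit_def)
  show "rho_max G i > 0"
    using crit[of 1 0] by (meson less_trans zero_le_one order_refl zero_less_one add_pos_nonneg)
qed

lemma human_load_pos: "human_load G D i > 0"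
  unfolding human_load_def using road_params_pos by (simp add: add_pos_nonneg)

lemma av_load_pos: "av_load G D i > 0"
  unfolding av_load_def using road_params_pos by (simp add: add_pos_nonneg)

lemma load_nonneg: "x \<ge> 0 \<Longrightarrow> y \<ge> 0 \<Longrightarrow> load G D i x y \<ge> 0"
  unfolding load_def using human_load_pos[of D] av_load_pos[of D] by simp

lemma load_pos: "x \<ge> 0 \<Longrightarrow> y \<ge> 0 \<Longrightarrow> x + y > 0 \<Longrightarrow> load G D i x y > 0"
  unfolding load_def using human_load_pos[of D] av_load_pos[of D]
  by (cases "x > 0") (auto intro: add_pos_nonneg add_nonneg_pos)

lemma load_mono_flow:
  "x \<le> x' \<Longrightarrow> y \<le> y' \<Longrightarrow> load G D i x y \<le> load G D i x' y'"
  unfolding load_def using human_load_pos[of D] av_load_pos[of D]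
  by (intro add_mono mult_left_mono) auto

text \<open>
  Congestion enters additively and depends on the total flow alone, so all comparisons between
  delays come from this identity and its linearity.
\<close>

lemma load_split:
  assumes "D \<ge> free_latency G i"
  shows "load G D i x y =
    load G (free_latency G i) i x y + (D - free_latency G i) * (x + y) / (len G i * rho_max G i)"
  using assms by (simp add: load_def human_load_def av_load_def algebra_simps add_divide_distrib
      diff_divide_distrib)

lemma load_mono_delay:
  assumes "D \<le> D'" "x \<ge> 0" "y \<ge> 0"
  shows "load G D i x y \<le> load G D' i x y"
proof -
  have "max 0 (D - free_latency G i) / (len G i * rho_max G i)
      \<le> max 0 (D' - free_latency G i) / (len G i * rho_max G i)"
    using road_params_pos assms by (intro divide_right_mono) auto
  then show ?thesis
    unfolding load_def human_load_def av_load_def using assms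
    by (intro add_mono mult_right_mono) auto
qed

lemma load_strict_mono_delay:
  assumes "free_latency G i \<le> D" "D < D'" "x \<ge> 0" "y \<ge> 0" "x + y > 0"
  shows "load G D i x y < load G D' i x y"
  using assms road_params_pos
  by (simp add: load_split[of D] load_split[of D'] divide_strict_right_mono)

text \<open>
  Dividing the flow by the maximum flow of its composition cancels the convex-combination weights in
  the critical density, which leaves a linear function: the load at the free-flow latency.
\<close>

lemma max_flow_iff_load:
  assumes "x \<ge> 0" "y \<ge> 0"
  shows "x + y \<le> max_flow G i x y \<longleftrightarrow> load G (free_latency G i) i x y \<le> 1"
    and "x + y > 0 \<Longrightarrow> x + y < max_flow G i x y \<longleftrightarrow> load G (free_latency G i) i x y < 1"
    and "x + y > 0 \<Longrightarrow> max_flow G i x y = (x + y) / load G (free_latency G i) i x y"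
proof -
  let ?l = "load G (free_latency G i) i x y"
  have flow: "max_flow G i x y = (x + y) / ?l" if "x + y > 0"
  proof -
    let ?w = "x * (hw_hv G i + veh_len G) + y * (hw_av G i + veh_len G)"
    have "y / (x + y) * hw_av G i + x / (x + y) * hw_hv G i + veh_len G = ?w / (x + y)"
    proof -
      have "y / (x + y) * hw_av G i + x / (x + y) * hw_hv G i + veh_len G
          = (y * hw_av G i + x * hw_hv G i + veh_len G * (x + y)) / (x + y)"
        using that by (simp add: add_divide_distrib)
      then show ?thesis by (simp add: algebra_simps)
    qed
    moreover have "?l = ?w / vfree G i"
      by (simp add: load_def human_load_def av_load_def add_divide_distrib algebra_simps)
    ultimately show ?thesis
      by (simp add: max_flow_def rho_crit_def)
  qed
  then show "x + y > 0 \<Longrightarrow> max_flow G i x y = (x + y) / ?l" .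
  show "x + y > 0 \<Longrightarrow> x + y < max_flow G i x y \<longleftrightarrow> ?l < 1"
    using load_pos[OF assms] flow by (simp add: pos_less_divide_eq mult_less_cancel_left2)
  show "x + y \<le> max_flow G i x y \<longleftrightarrow> ?l \<le> 1"
  proof (cases "x + y > 0")
    case True
    then show ?thesis using load_pos[OF assms True] flow
      by (simp add: pos_le_divide_eq mult_le_cancel_left2)
  next
    case False
    then have "x = 0" "y = 0" using assms by auto
    moreover have "veh_len G > 0" using valid unfolding valid_network_def by simp
    ultimately show ?thesis
      using road_params_pos by (simp add: load_def max_flow_def rho_crit_def)
  qed
qed

lemma congested_latency:
  assumes "x \<ge> 0" "y \<ge> 0" "x + y > 0"
  shows "latency G i x y True = free_latency G i
    + len G i * rho_max G i * (1 - load G (free_latency G i) i x y) / (x + y)"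
proof -
  let ?l = "load G (free_latency G i) i x y" and ?m = "max_flow G i x y"
  have pos: "?l > 0" using load_pos[OF assms] .
  have m: "?m = (x + y) / ?l" using max_flow_iff_load(3) assms by blast
  have "rho_crit G i x y = ?m / vfree G i" using road_params_pos by (simp add: max_flow_def)
  moreover have "?m > 0" using m pos assms by simp
  ultimately have "(rho_crit G i x y - rho_max G i) / ?m = 1 / vfree G i - rho_max G i / ?m"
    using road_params_pos by (simp add: field_simps)
  also have "rho_max G i / ?m = rho_max G i * ?l / (x + y)" using m by simp
  finally have "latency G i x y True = len G i * (rho_max G i / (x + y)
      + (1 / vfree G i - rho_max G i * ?l / (x + y)))"
    by (simp add: latency_def)
  then show ?thesis
    by (simp add: free_latency_def algebra_simps diff_divide_distrib)
qed

text \<open>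
  The reason for introducing loads: the level sets of the congested latency, a rational function of
  the two flows, are line segments.
\<close>

lemma congested_latency_eq_iff:
  assumes "x \<ge> 0" "y \<ge> 0" "x + y > 0" "free_latency G i \<le> D"
  shows "latency G i x y True = D \<longleftrightarrow> load G D i x y = 1"
  using assms road_params_pos
  by (auto simp: congested_latency load_split[of D] field_simps)

end

lemma uncongested_latency: "latency G i x y False = free_latency G i"
  by (simp add: latency_def free_latency_def)

section \<open>Equilibria as linear conditions\<close>

text \<open>
  For positive demand, the Nash equilibria with common delay \<open>D\<close>, written without latencies
  (\<open>equil_imp_nash\<close> and \<open>nash_imp_equil\<close>): once \<open>D\<close> is fixed, the constraints on the flows are
  linear.
\<close>

definition equil :: "network \<Rightarrow> real \<Rightarrow> real \<Rightarrow> real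
    \<Rightarrow> (nat \<Rightarrow> real) \<Rightarrow> (nat \<Rightarrow> real) \<Rightarrow> (nat \<Rightarrow> bool) \<Rightarrow> bool" where
  "equil G xb yb D x y s \<longleftrightarrow>
     (\<Sum>i\<in>{1..roads G}. x i) = xb \<and> (\<Sum>i\<in>{1..roads G}. y i) = yb \<and>
     (\<forall>i\<in>{1..roads G}. x i \<ge> 0 \<and> y i \<ge> 0 \<and> (s i \<longleftrightarrow> free_latency G i < D) \<and>
        (free_latency G i < D \<longrightarrow> load G D i (x i) (y i) = 1) \<and>
        (free_latency G i = D \<longrightarrow> load G D i (x i) (y i) \<le> 1) \<and>
        (free_latency G i > D \<longrightarrow> x i + y i = 0))"

lemma common_delay_unique:
  "common_delay G x y s D \<Longrightarrow> common_delay G x y s D' \<Longrightarrow> D = D'"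
  unfolding common_delay_def by metis

lemma robustness_congested: "s m \<Longrightarrow> robustness G xb yb m (x, y, s) = 0"
  by (simp add: robustness_def)

context
  fixes G :: network
  assumes valid: "valid_network G"
begin

lemma free_latency_less_iff:
  "i \<in> {1..roads G} \<Longrightarrow> j \<in> {1..roads G} \<Longrightarrow> free_latency G i < free_latency G j \<longleftrightarrow> i < j"
  using valid unfolding valid_network_def by (meson strict_mono_on_less)

lemma free_latency_le_iff:
  "i \<in> {1..roads G} \<Longrightarrow> j \<in> {1..roads G} \<Longrightarrow> free_latency G i \<le> free_latency G j \<longleftrightarrow> i \<le> j"
  using free_latency_less_iff[of j i] by force

context
  fixes xb yb :: real
  assumes demand: "xb + yb > 0"
begin

lemma some_flow:
  fixes x y :: "nat \<Rightarrow> real"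
  assumes "(\<Sum>i\<in>{1..roads G}. x i) = xb" "(\<Sum>i\<in>{1..roads G}. y i) = yb"
  shows "\<exists>i\<in>{1..roads G}. x i + y i > 0"
proof (rule ccontr)
  assume "\<not> ?thesis"
  then have "(\<Sum>i\<in>{1..roads G}. x i + y i) \<le> 0"
    by (intro sum_nonpos) (auto simp: not_less)
  then show False using demand assms by (simp add: sum.distrib)
qed

lemma equil_latency:
  assumes E: "equil G xb yb D x y s" and i: "i \<in> {1..roads G}"
  shows "latency G i (x i) (y i) (s i) = max D (free_latency G i)"
proof (cases "free_latency G i < D")
  case True
  then have *: "x i \<ge> 0" "y i \<ge> 0" "s i" "load G D i (x i) (y i) = 1"
    using E i unfolding equil_def by auto
  then have "x i \<noteq> 0 \<or> y i \<noteq> 0" by (auto simp: load_def)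
  then have "x i + y i > 0" using *(1,2) by linarith
  then show ?thesis
    using * True congested_latency_eq_iff[OF valid i, of "x i" "y i" D] by simp
next
  case False
  then have "s i = False" using E i unfolding equil_def by auto
  then show ?thesis using False by (simp add: uncongested_latency)
qed

lemma equil_flow_latency:
  assumes "equil G xb yb D x y s" "i \<in> {1..roads G}" "x i + y i > 0"
  shows "latency G i (x i) (y i) (s i) = D"
proof -
  have "\<not> free_latency G i > D"
    using assms unfolding equil_def by force
  then show ?thesis using equil_latency[OF assms(1,2)] by simp
qed

lemma equil_imp_nash:
  assumes E: "equil G xb yb D x y s"
  shows "nash G xb yb x y s" and "common_delay G x y s D"
proof -
  show "common_delay G x y s D"
    using E some_flow[of x y] equil_flow_latency[OF E]
    unfolding common_delay_def by (auto simp: equil_def)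
  have "x i + y i \<le> max_flow G i (x i) (y i) \<and>
        (s i \<longrightarrow> 0 < x i + y i \<and> x i + y i < max_flow G i (x i) (y i))"
    if i: "i \<in> {1..roads G}" for i
  proof -
    note [simp] = max_flow_iff_load(1,2)[OF valid i]
    have nn: "x i \<ge> 0" "y i \<ge> 0" using E i unfolding equil_def by auto
    consider "free_latency G i < D" | "free_latency G i = D" | "free_latency G i > D" by linarith
    then show ?thesis
    proof cases
      case 1
      then have l: "load G D i (x i) (y i) = 1" using E i unfolding equil_def by auto
      then have "x i \<noteq> 0 \<or> y i \<noteq> 0" by (auto simp: load_def)
      then have p: "x i + y i > 0" using nn by linarith
      then have "load G (free_latency G i) i (x i) (y i) < 1"
        using load_strict_mono_delay[OF valid i _ 1 nn] l by simp
      then show ?thesis using p nn by simp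
    next
      case 2
      then show ?thesis using E i nn unfolding equil_def by auto
    next
      case 3
      then have "x i = 0" "y i = 0" "\<not> s i" using E i nn unfolding equil_def by force+
      then show ?thesis using max_flow_iff_load(1)[OF valid i, of 0 0] by (simp add: load_def)
    qed
  qed
  then have "feasible G xb yb x y s"
    using E unfolding feasible_def equil_def by auto
  then show "nash G xb yb x y s"
    unfolding nash_def using equil_flow_latency[OF E] equil_latency[OF E] by simp
qed

text \<open>
  A used road is congested exactly if \<open>D\<close> exceeds its free-flow latency, because congestion strictly
  below capacity costs strictly more than free flow. An unused road shows its free-flow latency,
  which the equilibrium condition bounds below by \<open>D\<close>.
\<close>

lemma nash_imp_equil:
  assumes N: "nash G xb yb x y s" and C: "common_delay G x y s D"
  shows "equil G xb yb D x y s"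
proof -
  have F: "feasible G xb yb x y s" using N unfolding nash_def by blast
  obtain u where u: "u \<in> {1..roads G}" "x u + y u > 0" "latency G u (x u) (y u) (s u) = D"
    using C unfolding common_delay_def by blast
  have "(s i \<longleftrightarrow> free_latency G i < D) \<and>
        (free_latency G i < D \<longrightarrow> load G D i (x i) (y i) = 1) \<and>
        (free_latency G i = D \<longrightarrow> load G D i (x i) (y i) \<le> 1) \<and>
        (free_latency G i > D \<longrightarrow> x i + y i = 0)" if i: "i \<in> {1..roads G}" for i
  proof -
    have nn: "x i \<ge> 0" "y i \<ge> 0" using F i unfolding feasible_def by auto
    have cap: "load G (free_latency G i) i (x i) (y i) \<le> 1"
      using F i max_flow_iff_load(1)[OF valid i nn] unfolding feasible_def by simp
    show ?thesis
    proof (cases "x i + y i > 0")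
      case flow: True
      then have lat: "latency G i (x i) (y i) (s i) = D"
        using C i unfolding common_delay_def by blast
      show ?thesis
      proof (cases "s i")
        case True
        have "load G (free_latency G i) i (x i) (y i) < 1"
          using F i True max_flow_iff_load(2)[OF valid i nn flow] unfolding feasible_def by simp
        then have "len G i * rho_max G i * (1 - load G (free_latency G i) i (x i) (y i))
            / (x i + y i) > 0"
          using road_params_pos[OF valid i] flow by simp
        then have "free_latency G i < D"
          using congested_latency[OF valid i nn flow] lat True by simp
        then show ?thesis
          using True lat congested_latency_eq_iff[OF valid i nn flow, of D] by simp
      next
        case False
        then have "free_latency G i = D" using lat by (simp add: uncongested_latency)
        then show ?thesis using False cap by simp
      qed
    next
      case False
      then have "x i + y i = 0" using nn by linarith
      moreover have "\<not> s i" using False F i unfolding feasible_def by blast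
      moreover have "D \<le> latency G i (x i) (y i) (s i)"
        using N u i unfolding nash_def by auto
      ultimately show ?thesis using cap by (auto simp: uncongested_latency)
    qed
  qed
  then show ?thesis using F unfolding equil_def feasible_def by auto
qed

lemma nash_equil:
  assumes N: "nash G xb yb x y s"
  shows "\<exists>D. equil G xb yb D x y s"
proof -
  have F: "feasible G xb yb x y s" using N unfolding nash_def by blast
  obtain u where u: "u \<in> {1..roads G}" "x u + y u > 0"
    using some_flow[of x y] F unfolding feasible_def by blast
  have "common_delay G x y s (latency G u (x u) (y u) (s u))"
    unfolding common_delay_def using N u unfolding nash_def by (meson order_antisym)
  then show ?thesis using nash_imp_equil[OF N] by blast
qed

lemma total_latency_equil:
  assumes E: "equil G xb yb D x y s"
  shows "total_latency G (x, y, s) = D * (xb + yb)"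
proof -
  have "(x i + y i) * latency G i (x i) (y i) (s i) = D * (x i + y i)"
    if "i \<in> {1..roads G}" for i
  proof (cases "x i + y i > 0")
    case True
    then show ?thesis using equil_flow_latency[OF E that] by simp
  next
    case False
    then have "x i + y i = 0" using E that unfolding equil_def by force
    then show ?thesis by simp
  qed
  then have "total_latency G (x, y, s) = (\<Sum>i\<in>{1..roads G}. D * (x i + y i))"
    unfolding total_latency_def split by (rule sum.cong[OF refl])
  also have "\<dots> = D * (xb + yb)"
    using E unfolding equil_def by (simp add: sum.distrib flip: sum_distrib_left)
  finally show ?thesis .
qed

text \<open>
  Since the delay of every road is \<open>max D (free_latency G i)\<close> in an equilibrium, the longest
  equilibrium road is determined by \<open>D\<close>: it is the last road whose free-flow latency is at most \<open>D\<close>.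
\<close>

lemma NE_iff:
  "(x, y, s) \<in> NE G xb yb m \<longleftrightarrow>
     (\<exists>D. equil G xb yb D x y s \<and> m \<in> {1..roads G} \<and> free_latency G m \<le> D \<and>
        (\<forall>j\<in>{1..roads G}. free_latency G j \<le> D \<longrightarrow> j \<le> m))"
  (is "?L \<longleftrightarrow> ?R")
proof
  assume ?L
  then obtain D where N: "nash G xb yb x y s" and C: "common_delay G x y s D"
    and A: "is_arg_max (free_latency G)
            (\<lambda>j. j \<in> {1..roads G} \<and> latency G j (x j) (y j) (s j) = D) m"
    unfolding NE_def longest_road_def by blast
  have E: "equil G xb yb D x y s" using nash_imp_equil[OF N C] .
  have lat: "latency G j (x j) (y j) (s j) = D \<longleftrightarrow> free_latency G j \<le> D"
    if "j \<in> {1..roads G}" for j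
    using equil_latency[OF E that] by auto
  have m: "m \<in> {1..roads G}" "free_latency G m \<le> D"
    using A lat unfolding is_arg_max_def by auto
  moreover have "j \<le> m" if "j \<in> {1..roads G}" "free_latency G j \<le> D" for j
    using A lat[OF that(1)] that m free_latency_less_iff[OF m(1) that(1)]
    unfolding is_arg_max_def by force
  ultimately show ?R using E by blast
next
  assume ?R
  then obtain D where E: "equil G xb yb D x y s" and m: "m \<in> {1..roads G}" "free_latency G m \<le> D"
    and M: "\<forall>j\<in>{1..roads G}. free_latency G j \<le> D \<longrightarrow> j \<le> m" by blast
  have lat: "latency G j (x j) (y j) (s j) = D \<longleftrightarrow> free_latency G j \<le> D"
    if "j \<in> {1..roads G}" for j
    using equil_latency[OF E that] by auto
  have "is_arg_max (free_latency G)
            (\<lambda>j. j \<in> {1..roads G} \<and> latency G j (x j) (y j) (s j) = D) m"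
    unfolding is_arg_max_def
  proof (intro conjI notI m(1))
    show "latency G m (x m) (y m) (s m) = D" using lat[OF m(1)] m(2) by blast
    assume "\<exists>j. (j \<in> {1..roads G} \<and> latency G j (x j) (y j) (s j) = D)
      \<and> free_latency G m < free_latency G j"
    then obtain j where "j \<in> {1..roads G}" "free_latency G j \<le> D" "m < j"
      using lat free_latency_less_iff[OF m(1)] by blast
    then show False using M by force
  qed
  then show ?L
    using equil_imp_nash[OF E] unfolding NE_def longest_road_def by blast
qed

lemma equil_at_free_latency_NE:
  assumes "equil G xb yb (free_latency G m) x y s" "m \<in> {1..roads G}"
  shows "(x, y, s) \<in> NE G xb yb m"
  unfolding NE_iff using assms free_latency_le_iff[OF _ assms(2)] by blast

section \<open>Lowering the common delay\<close>

text \<open>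
  A relaxation of \<open>equil\<close> at the free-flow latency of road \<open>m\<close>: the demand fits into the roads up
  to \<open>m\<close>, but the roads before \<open>m\<close> need not be full.
\<close>

definition packing :: "nat \<Rightarrow> (nat \<Rightarrow> real) \<Rightarrow> (nat \<Rightarrow> real) \<Rightarrow> bool" where
  "packing m x y \<longleftrightarrow>
     (\<Sum>i\<in>{1..roads G}. x i) = xb \<and> (\<Sum>i\<in>{1..roads G}. y i) = yb \<and>
     (\<forall>i\<in>{1..roads G}. x i \<ge> 0 \<and> y i \<ge> 0 \<and>
        load G (free_latency G m) i (x i) (y i) \<le> 1 \<and> (i > m \<longrightarrow> x i + y i = 0))"

text \<open>
  Moving a fraction of the whole flow of road \<open>m\<close>, human-driven and autonomous in the same
  proportion, to road \<open>k\<close> changes the load of \<open>k\<close> linearly in that fraction. Hence either some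
  fraction fills road \<open>k\<close> exactly, or all flow of road \<open>m\<close> fits.
\<close>

lemma fill_road:
  assumes P: "packing m x y" and m: "m \<in> {1..roads G}" and k: "k \<in> {1..<m}"
  shows "\<exists>x' y'. packing m x' y' \<and> x' m \<le> x m \<and> y' m \<le> y m \<and>
    (\<forall>i. i \<noteq> m \<longrightarrow> i \<noteq> k \<longrightarrow> x' i = x i \<and> y' i = y i) \<and>
    (x' m + y' m = 0 \<or> load G (free_latency G m) k (x' k) (y' k) = 1)"
proof (cases "x m + y m = 0")
  case True
  then show ?thesis using P by blast
next
  case False
  let ?D = "free_latency G m"
  have kr: "k \<in> {1..roads G}" "k \<noteq> m" using k m by auto
  have nn: "x m \<ge> 0" "y m \<ge> 0" "x k \<ge> 0" "y k \<ge> 0" and lk: "load G ?D k (x k) (y k) \<le> 1"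
    using P m kr unfolding packing_def by auto
  define q where "q = load G ?D k (x m) (y m)"
  have q: "q > 0" unfolding q_def using load_pos[OF valid kr(1) nn(1,2)] False nn by simp
  \<comment> \<open>the fraction that fills road \<open>k\<close>, capped by moving everything\<close>
  define t where "t = min 1 ((1 - load G ?D k (x k) (y k)) / q)"
  have t: "0 \<le> t" "t \<le> 1" using q lk by (auto simp: t_def)
  define x' where "x' = x(k := x k + t * x m, m := (1 - t) * x m)"
  define y' where "y' = y(k := y k + t * y m, m := (1 - t) * y m)"
  have move: "(\<Sum>i\<in>{1..roads G}. (f(k := f k + t * f m, m := (1 - t) * f m)) i)
      = (\<Sum>i\<in>{1..roads G}. f i)" for f :: "nat \<Rightarrow> real"
  proof -
    let ?g = "f(k := f k + t * f m, m := (1 - t) * f m)"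
    have "(\<Sum>i\<in>{1..roads G}. h i) = h k + h m + (\<Sum>i\<in>{1..roads G} - {k} - {m}. h i)"
      for h :: "nat \<Rightarrow> real"
      using kr m sum.remove[of "{1..roads G}" k h] sum.remove[of "{1..roads G} - {k}" m h]
      by (simp add: add.assoc)
    from this[of f] this[of ?g] show ?thesis
      using kr(2) by (simp add: algebra_simps)
  qed
  have "load G ?D k (x' k) (y' k) = load G ?D k (x k) (y k) + t * q"
    using kr(2) by (simp add: x'_def y'_def q_def load_def algebra_simps)
  moreover have "t * q \<le> 1 - load G ?D k (x k) (y k)"
    using q by (simp add: t_def min_def field_simps)
  moreover have "t = 1 \<or> t * q = 1 - load G ?D k (x k) (y k)"
    using q by (auto simp: t_def min_def)
  ultimately have loadk: "load G ?D k (x' k) (y' k) \<le> 1"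
    "t = 1 \<or> load G ?D k (x' k) (y' k) = 1" by auto
  have le: "x' m \<le> x m" "y' m \<le> y m"
    using t nn by (auto simp: x'_def y'_def algebra_simps)
  have "load G ?D m (x' m) (y' m) \<le> 1"
    using load_mono_flow[OF valid m le, of ?D] P m unfolding packing_def by fastforce
  then have "load G ?D i (x' i) (y' i) \<le> 1" if "i \<in> {1..roads G}" for i
    using loadk(1) P that unfolding packing_def by (cases "i = k"; cases "i = m") (auto simp: x'_def y'_def)
  moreover have "x' i \<ge> 0 \<and> y' i \<ge> 0 \<and> (i > m \<longrightarrow> x' i + y' i = 0)" if "i \<in> {1..roads G}" for i
    using P that t k nn unfolding packing_def x'_def y'_def by auto
  moreover have "(\<Sum>i\<in>{1..roads G}. x' i) = xb" "(\<Sum>i\<in>{1..roads G}. y' i) = yb"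
    using P unfolding packing_def x'_def y'_def move by auto
  ultimately have "packing m x' y'" unfolding packing_def by blast
  moreover have "x' m + y' m = 0 \<or> load G ?D k (x' k) (y' k) = 1"
    using loadk(2) by (auto simp: x'_def y'_def)
  moreover have "\<forall>i. i \<noteq> m \<longrightarrow> i \<noteq> k \<longrightarrow> x' i = x i \<and> y' i = y i"
    by (simp add: x'_def y'_def)
  ultimately show ?thesis using le by blast
qed

lemma fill_roads:
  assumes P: "packing m x y" and m: "m \<in> {1..roads G}" and k: "k < m"
  shows "\<exists>x' y'. packing m x' y' \<and> x' m \<le> x m \<and> y' m \<le> y m \<and>
    (x' m + y' m = 0 \<or> (\<forall>i\<in>{1..k}. load G (free_latency G m) i (x' i) (y' i) = 1))"
  using k
proof (induction k)
  case 0
  then show ?case using P by (intro exI[of _ x] exI[of _ y]) auto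
next
  case (Suc k)
  let ?D = "free_latency G m"
  from Suc obtain x1 y1 where 1: "packing m x1 y1" "x1 m \<le> x m" "y1 m \<le> y m"
    "x1 m + y1 m = 0 \<or> (\<forall>i\<in>{1..k}. load G ?D i (x1 i) (y1 i) = 1)" by auto
  obtain x2 y2 where 2: "packing m x2 y2" "x2 m \<le> x1 m" "y2 m \<le> y1 m"
    "\<forall>i. i \<noteq> m \<longrightarrow> i \<noteq> Suc k \<longrightarrow> x2 i = x1 i \<and> y2 i = y1 i"
    "x2 m + y2 m = 0 \<or> load G ?D (Suc k) (x2 (Suc k)) (y2 (Suc k)) = 1"
    using fill_road[OF 1(1) m, of "Suc k"] Suc.prems by auto
  have nn: "x2 m \<ge> 0" "y2 m \<ge> 0" using 2(1) m unfolding packing_def by auto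
  have "x2 m + y2 m = 0 \<or> (\<forall>i\<in>{1..Suc k}. load G ?D i (x2 i) (y2 i) = 1)"
  proof (cases "x2 m + y2 m = 0")
    case False
    then have "\<not> x1 m + y1 m = 0" using nn 2(2,3) by linarith
    then have "\<forall>i\<in>{1..k}. load G ?D i (x1 i) (y1 i) = 1" using 1(4) by blast
    then show ?thesis using 2(4,5) False Suc.prems by (auto simp: le_Suc_eq)
  qed simp
  then show ?case using 1(2,3) 2(1-3) by (intro exI[of _ x2] exI[of _ y2]) auto
qed

text \<open>
  Filling the roads before \<open>m\<close> from road \<open>m\<close> either succeeds, giving an equilibrium with delay
  \<open>free_latency G m\<close>, or empties road \<open>m\<close>. In the latter case the demand fits into the roads up
  to \<open>m - 1\<close>, even at the smaller delay, since loads increase with the delay. The bounds on the flow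
  of road \<open>m\<close> are what later shows that a congested equilibrium leaves spare capacity behind.
\<close>

lemma packing_dichotomy:
  assumes P: "packing m x y" and m: "m \<in> {1..roads G}"
  shows "(\<exists>x' y'. m - 1 \<in> {1..roads G} \<and> packing (m - 1) x' y') \<or>
    (\<exists>x' y' s'. equil G xb yb (free_latency G m) x' y' s' \<and> x' m \<le> x m \<and> y' m \<le> y m)"
proof -
  let ?D = "free_latency G m"
  obtain x' y' where *: "packing m x' y'" "x' m \<le> x m" "y' m \<le> y m"
    "x' m + y' m = 0 \<or> (\<forall>i\<in>{1..m - 1}. load G ?D i (x' i) (y' i) = 1)"
    using fill_roads[OF P m, of "m - 1"] m by auto
  show ?thesis
  proof (cases "x' m + y' m = 0 \<and> m > 1")
    case True
    then have m1: "m - 1 \<in> {1..roads G}" using m by auto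
    have "load G (free_latency G (m - 1)) i (x' i) (y' i) \<le> 1" if "i \<in> {1..roads G}" for i
    proof -
      have "load G (free_latency G (m - 1)) i (x' i) (y' i) \<le> load G ?D i (x' i) (y' i)"
        using *(1) that m1 m unfolding packing_def
        by (intro load_mono_delay[OF valid that]) (auto simp: free_latency_le_iff)
      then show ?thesis using *(1) that unfolding packing_def by fastforce
    qed
    moreover have "x' i + y' i = 0" if "i \<in> {1..roads G}" "i > m - 1" for i
      using True *(1) that unfolding packing_def by (cases "i = m") auto
    ultimately have "packing (m - 1) x' y'"
      using *(1) unfolding packing_def by blast
    then show ?thesis using m1 by blast
  next
    case False
    then have full: "\<forall>i\<in>{1..m - 1}. load G ?D i (x' i) (y' i) = 1" using *(4) by auto
    have "equil G xb yb ?D x' y' (\<lambda>i. free_latency G i < ?D)"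
      using *(1) full m unfolding equil_def packing_def
      by (auto simp: free_latency_less_iff)
    then show ?thesis using *(2,3) by blast
  qed
qed

lemma packing_equil:
  assumes "packing m x y" "m \<in> {1..roads G}"
  shows "\<exists>m' x' y' s'. m' \<in> {1..m} \<and> equil G xb yb (free_latency G m') x' y' s'"
  using assms
proof (induction m arbitrary: x y rule: less_induct)
  case (less m)
  from packing_dichotomy[OF less.prems] show ?case
  proof
    assume "\<exists>x' y'. m - 1 \<in> {1..roads G} \<and> packing (m - 1) x' y'"
    then obtain x' y' where m1: "m - 1 \<in> {1..roads G}" "packing (m - 1) x' y'" by blast
    then have "m - 1 < m" by auto
    from less.IH[OF this m1(2,1)] show ?thesis by (meson atLeastAtMost_iff diff_le_self le_trans)
  next
    assume "\<exists>x' y' s'. equil G xb yb (free_latency G m) x' y' s' \<and> x' m \<le> x m \<and> y' m \<le> y m"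
    then show ?thesis using less.prems(2) by (meson atLeastAtMost_iff le_refl)
  qed
qed

lemma equil_packing:
  assumes E: "equil G xb yb D x y s" and m: "m \<in> {1..roads G}" "free_latency G m \<le> D"
    and M: "\<forall>j\<in>{1..roads G}. free_latency G j \<le> D \<longrightarrow> j \<le> m"
  shows "packing m x y"
proof -
  have "load G (free_latency G m) i (x i) (y i) \<le> 1" "i > m \<longrightarrow> x i + y i = 0"
    if i: "i \<in> {1..roads G}" for i
  proof -
    have nn: "x i \<ge> 0" "y i \<ge> 0" using E i unfolding equil_def by auto
    have "load G (free_latency G m) i (x i) (y i) \<le> load G D i (x i) (y i)"
      using load_mono_delay[OF valid i m(2) nn] .
    moreover have "load G D i (x i) (y i) \<le> 1" if "free_latency G i \<le> D"
      using E i that unfolding equil_def by force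
    moreover have "x i = 0 \<and> y i = 0" if "free_latency G i > D"
      using E i that nn unfolding equil_def by force
    ultimately show "load G (free_latency G m) i (x i) (y i) \<le> 1" "i > m \<longrightarrow> x i + y i = 0"
      using M i by (force simp: load_def not_le)+
  qed
  then show ?thesis using E unfolding packing_def equil_def by auto
qed

lemma NE_nonempty_equil:
  assumes "r \<in> NE G xb yb m"
  shows "\<exists>m' x y s. m' \<in> {1..m} \<and> equil G xb yb (free_latency G m') x y s"
proof -
  obtain x y s where r: "r = (x, y, s)" by (cases r)
  with assms obtain D where "equil G xb yb D x y s" "m \<in> {1..roads G}" "free_latency G m \<le> D"
    "\<forall>j\<in>{1..roads G}. free_latency G j \<le> D \<longrightarrow> j \<le> m"
    unfolding NE_iff r by blast
  then show ?thesis using equil_packing packing_equil by metis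
qed

lemma NE_road: "r \<in> NE G xb yb m \<Longrightarrow> m \<in> {1..roads G}"
  by (cases r) (auto simp: NE_iff)

text \<open>
  Adding the fraction \<open>\<gamma>\<close> of the demand to road \<open>m\<close> adds \<open>\<gamma>\<close> times the load of the demand.
  Negative \<open>\<gamma>\<close>, for which the flows may be negative and the capacity meaningless, cannot be
  maximal because \<open>\<gamma> = 0\<close> is admissible.
\<close>

lemma robustness_eq:
  assumes E: "equil G xb yb (free_latency G m) x y s" and m: "m \<in> {1..roads G}"
    and nn: "xb \<ge> 0" "yb \<ge> 0"
  shows "robustness G xb yb m (x, y, s) =
    (1 - load G (free_latency G m) m (x m) (y m)) / load G (free_latency G m) m xb yb"
proof -
  let ?l = "load G (free_latency G m) m"
  let ?P = "\<lambda>\<gamma>. x m + y m + \<gamma> * (xb + yb) \<le> max_flow G m (x m + \<gamma> * xb) (y m + \<gamma> * yb)"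
  define g where "g = (1 - ?l (x m) (y m)) / ?l xb yb"
  have s: "\<not> s m" and xy: "x m \<ge> 0" "y m \<ge> 0" "?l (x m) (y m) \<le> 1"
    using E m unfolding equil_def by auto
  have l: "?l xb yb > 0" using load_pos[OF valid m nn demand] .
  have g: "g \<ge> 0" using xy(3) l unfolding g_def by simp
  have P: "?P \<gamma> \<longleftrightarrow> ?l (x m) (y m) + \<gamma> * ?l xb yb \<le> 1" if "\<gamma> \<ge> 0" for \<gamma>
  proof -
    have "?P \<gamma> \<longleftrightarrow> ?l (x m + \<gamma> * xb) (y m + \<gamma> * yb) \<le> 1"
      using that xy nn
      by (subst max_flow_iff_load(1)[OF valid m, symmetric]) (auto simp: algebra_simps)
    then show ?thesis by (simp add: load_def algebra_simps)
  qed
  have "(GREATEST \<gamma>. ?P \<gamma>) = g"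
  proof (rule Greatest_equality)
    show "?P g" using P[OF g] l by (simp add: g_def)
  next
    fix \<gamma> assume "?P \<gamma>"
    show "\<gamma> \<le> g"
    proof (cases "\<gamma> \<ge> 0")
      case True
      then have "?l (x m) (y m) + \<gamma> * ?l xb yb \<le> 1" using P \<open>?P \<gamma>\<close> by blast
      then show ?thesis using l by (simp add: g_def field_simps)
    next
      case False
      then show ?thesis using g by simp
    qed
  qed
  then show ?thesis using s by (simp add: robustness_def g_def)
qed

end

end

section \<open>Best equilibria and the two-stage problem\<close>

lemma first_NE_equil:
  assumes valid: "valid_network G" and demand: "xb + yb > 0"
    and r: "r \<in> NE G xb yb m" and first: "\<And>k. k < m \<Longrightarrow> NE G xb yb k = {}"
  obtains x y s where "equil G xb yb (free_latency G m) x y s"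
proof -
  obtain k x y s where k: "k \<in> {1..m}" and E: "equil G xb yb (free_latency G k) x y s"
    using NE_nonempty_equil[OF valid demand r] by blast
  have "k \<in> {1..roads G}" using k NE_road[OF valid demand r] by auto
  then have "NE G xb yb k \<noteq> {}" using equil_at_free_latency_NE[OF valid demand E] by blast
  then have "\<not> k < m" using first by blast
  then have "k = m" using k by simp
  then show thesis using that E by blast
qed

lemma m_EQ_iff:
  assumes valid: "valid_network G" and demand: "xb + yb > 0"
  shows "m_EQ G xb yb m \<longleftrightarrow> NE G xb yb m \<noteq> {} \<and> (\<forall>k<m. NE G xb yb k = {})"
proof -
  have road: "k \<in> {1..roads G}" if "NE G xb yb k \<noteq> {}" for k
    using that NE_road[OF valid demand] by blast
  have "m_EQ G xb yb m \<longleftrightarrow> NE G xb yb m \<noteq> {} \<and>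
      (\<forall>k. NE G xb yb k \<noteq> {} \<longrightarrow> \<not> free_latency G k < free_latency G m)"
    unfolding m_EQ_def is_arg_min_def using road by blast
  also have "\<dots> \<longleftrightarrow> NE G xb yb m \<noteq> {} \<and> (\<forall>k. NE G xb yb k \<noteq> {} \<longrightarrow> \<not> k < m)"
  proof -
    have "free_latency G k < free_latency G m \<longleftrightarrow> k < m"
      if "NE G xb yb k \<noteq> {}" "NE G xb yb m \<noteq> {}" for k
      using free_latency_less_iff[OF valid road[OF that(1)] road[OF that(2)]] .
    then show ?thesis by meson
  qed
  finally show ?thesis by blast
qed

lemma equil_robustness_nonneg:
  assumes valid: "valid_network G" and demand: "xb + yb > 0" and nn: "xb \<ge> 0" "yb \<ge> 0"
    and m: "m \<in> {1..roads G}" and E: "equil G xb yb (free_latency G m) x y s"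
  shows "robustness G xb yb m (x, y, s) \<ge> 0"
  using E m load_pos[OF valid m nn demand, of "free_latency G m"]
  unfolding robustness_eq[OF valid demand E m nn] equil_def by simp

text \<open>
  If the longest road is congested, its common delay \<open>D\<close> exceeds \<open>free_latency G m\<close>, so at the
  latter delay every used road has spare capacity. Filling only takes flow away from road \<open>m\<close>, which
  therefore keeps spare capacity, that is, positive robustness. Without this lemma congested
  equilibria could tie with the best ones at robustness \<open>0\<close>.
\<close>

lemma congested_NE_imp_robust_equil:
  assumes valid: "valid_network G" and demand: "xb + yb > 0" and nn: "xb \<ge> 0" "yb \<ge> 0"
    and mEQ: "m_EQ G xb yb m"
    and r: "(x, y, s) \<in> NE G xb yb m" and sm: "s m"
  shows "\<exists>r'\<in>NE G xb yb m. robustness G xb yb m r' > 0"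
proof -
  have first: "\<And>k. k < m \<Longrightarrow> NE G xb yb k = {}" using mEQ m_EQ_iff[OF valid demand] by blast
  obtain D where E: "equil G xb yb D x y s" and m: "m \<in> {1..roads G}" "free_latency G m \<le> D"
    and M: "\<forall>j\<in>{1..roads G}. free_latency G j \<le> D \<longrightarrow> j \<le> m"
    using r unfolding NE_iff[OF valid demand] by blast
  have D: "free_latency G m < D" using E m sm unfolding equil_def by blast
  have P: "packing G xb yb m x y" using equil_packing[OF valid demand E m M] .
  have less: "load G (free_latency G m) m (x m) (y m) < 1"
  proof -
    have *: "x m \<ge> 0" "y m \<ge> 0" "load G D m (x m) (y m) = 1"
      using E m(1) D unfolding equil_def by auto
    then have "x m \<noteq> 0 \<or> y m \<noteq> 0" by (auto simp: load_def)
    then have "x m + y m > 0" using * by linarith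
    then show ?thesis using load_strict_mono_delay[OF valid m(1) order_refl D *(1,2)] * by simp
  qed
  from packing_dichotomy[OF valid demand P m(1)] show ?thesis
  proof
    assume "\<exists>x' y'. m - 1 \<in> {1..roads G} \<and> packing G xb yb (m - 1) x' y'"
    then obtain x' y' where m1: "m - 1 \<in> {1..roads G}" "packing G xb yb (m - 1) x' y'" by blast
    from packing_equil[OF valid demand m1(2,1)] obtain k x2 y2 s2
      where "k \<in> {1..m - 1}" "equil G xb yb (free_latency G k) x2 y2 s2" by blast
    moreover then have "k < m" "k \<in> {1..roads G}" using m1(1) by auto
    ultimately have False
      using first[of k] equil_at_free_latency_NE[OF valid demand, of k x2 y2 s2] by blast
    then show ?thesis ..
  next
    assume "\<exists>x' y' s'. equil G xb yb (free_latency G m) x' y' s' \<and> x' m \<le> x m \<and> y' m \<le> y m"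
    then obtain x' y' s' where E': "equil G xb yb (free_latency G m) x' y' s'"
      and le: "x' m \<le> x m" "y' m \<le> y m" by blast
    have "load G (free_latency G m) m (x' m) (y' m) < 1"
      using load_mono_flow[OF valid m(1) le, of "free_latency G m"] less by simp
    then have "robustness G xb yb m (x', y', s') > 0"
      unfolding robustness_eq[OF valid demand E' m(1) nn]
      using load_pos[OF valid m(1) nn demand, of "free_latency G m"] by simp
    then show ?thesis using equil_at_free_latency_NE[OF valid demand E' m(1)] by blast
  qed
qed

text \<open>
  The total latency is the common delay times the demand, so the best equilibria are those of least
  delay. The delay of any equilibrium is at least the free-flow latency of its longest road, hence at
  least that of \<open>m\<close>, and this bound is attained.
\<close>

lemma BNE_iff:
  assumes valid: "valid_network G" and demand: "xb + yb > 0" and mEQ: "m_EQ G xb yb m"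
  shows "(x, y, s) \<in> BNE G xb yb \<longleftrightarrow> equil G xb yb (free_latency G m) x y s"
proof -
  have ne: "NE G xb yb m \<noteq> {}" and first: "\<And>k. k < m \<Longrightarrow> NE G xb yb k = {}"
    using mEQ m_EQ_iff[OF valid demand] by auto
  have m: "m \<in> {1..roads G}" using ne NE_road[OF valid demand] by blast
  obtain x0 y0 s0 where E0: "equil G xb yb (free_latency G m) x0 y0 s0"
  proof -
    obtain r where "r \<in> NE G xb yb m" using ne by blast
    from first_NE_equil[OF valid demand this first] that show thesis by blast
  qed
  have lower: "free_latency G m \<le> D" if E: "equil G xb yb D x y s" for D x y s
  proof -
    let ?Q = "{j \<in> {1..roads G}. free_latency G j \<le> D}"
    obtain u where u: "u \<in> {1..roads G}" "x u + y u > 0"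
      using E some_flow[OF valid demand, of x y] unfolding equil_def by blast
    have "\<not> free_latency G u > D" using E u unfolding equil_def by force
    then have Q: "finite ?Q" "?Q \<noteq> {}" using u by auto
    then have k: "Max ?Q \<in> ?Q" by (rule Max_in)
    have "\<forall>j\<in>{1..roads G}. free_latency G j \<le> D \<longrightarrow> j \<le> Max ?Q" using Q by simp
    then have "(x, y, s) \<in> NE G xb yb (Max ?Q)"
      unfolding NE_iff[OF valid demand] using E k by blast
    then have "m \<le> Max ?Q" using first[of "Max ?Q"] by force
    then have "free_latency G m \<le> free_latency G (Max ?Q)"
      using k m free_latency_le_iff[OF valid, of m "Max ?Q"] by blast
    then show ?thesis using k by simp
  qed
  show ?thesis
  proof
    assume B: "(x, y, s) \<in> BNE G xb yb"
    then have N: "nash G xb yb x y s" unfolding BNE_def is_arg_min_def by simp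
    obtain D where E: "equil G xb yb D x y s" using nash_equil[OF valid demand N] by blast
    have "\<not> total_latency G (x0, y0, s0) < total_latency G (x, y, s)"
      using B equil_imp_nash(1)[OF valid demand E0] unfolding BNE_def is_arg_min_def by blast
    then have "D * (xb + yb) \<le> free_latency G m * (xb + yb)"
      by (simp add: total_latency_equil[OF valid demand E] total_latency_equil[OF valid demand E0])
    then have "D \<le> free_latency G m" using demand by simp
    then show "equil G xb yb (free_latency G m) x y s" using E lower[OF E] by simp
  next
    assume E: "equil G xb yb (free_latency G m) x y s"
    have "\<not> total_latency G (x', y', s') < total_latency G (x, y, s)"
      if N': "nash G xb yb x' y' s'" for x' y' s'
    proof -
      obtain D where E': "equil G xb yb D x' y' s'" using nash_equil[OF valid demand N'] by blast
      have "free_latency G m * (xb + yb) \<le> D * (xb + yb)"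
        using lower[OF E'] demand by (intro mult_right_mono) auto
      then show ?thesis
        by (simp add: total_latency_equil[OF valid demand E] total_latency_equil[OF valid demand E'])
    qed
    then show "(x, y, s) \<in> BNE G xb yb"
      using equil_imp_nash(1)[OF valid demand E] unfolding BNE_def is_arg_min_def by auto
  qed
qed

lemma zero_demand_no_NE:
  assumes "xb \<ge> 0" "yb \<ge> 0" "\<not> xb + yb > 0"
  shows "NE G xb yb m = {}"
proof -
  have "\<not> common_delay G x y s D" if "feasible G xb yb x y s" for x y s D
  proof
    assume "common_delay G x y s D"
    then obtain i where i: "i \<in> {1..roads G}" "x i + y i > 0"
      unfolding common_delay_def by blast
    have "x i + y i \<le> (\<Sum>i\<in>{1..roads G}. x i + y i)"
      using that i(1) unfolding feasible_def by (intro member_le_sum) auto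
    also have "\<dots> = xb + yb" using that unfolding feasible_def by (simp add: sum.distrib)
    finally show False using assms i by simp
  qed
  then show ?thesis unfolding NE_def longest_road_def nash_def by blast
qed

lemma two_stage_empty_if_no_NE:
  "(\<And>m. NE G xb yb m = {}) \<Longrightarrow> two_stage G xb yb = {}"
  unfolding two_stage_def m_EQ_def is_arg_min_def by simp

lemma m_EQ_exists:
  assumes valid: "valid_network G" and demand: "xb + yb > 0" and "NE G xb yb m \<noteq> {}"
  obtains k where "m_EQ G xb yb k"
  using m_EQ_iff[OF valid demand] assms(3) exists_least_iff[of "\<lambda>m. NE G xb yb m \<noteq> {}"] by blast

lemma m_EQ_unique:
  assumes valid: "valid_network G" and demand: "xb + yb > 0"
    and "m_EQ G xb yb m" "m_EQ G xb yb k"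
  shows "m = k"
  using assms(3,4) unfolding m_EQ_iff[OF valid demand] by (metis nat_neq_iff)

lemma NE_of_BNE:
  assumes valid: "valid_network G" and demand: "xb + yb > 0" and mEQ: "m_EQ G xb yb m"
    and r: "r \<in> BNE G xb yb"
  shows "r \<in> NE G xb yb k \<longleftrightarrow> k = m"
proof -
  obtain x y s where r': "r = (x, y, s)" by (cases r)
  have E: "equil G xb yb (free_latency G m) x y s"
    using r BNE_iff[OF valid demand mEQ] r' by blast
  have m: "m \<in> {1..roads G}" using mEQ unfolding m_EQ_def is_arg_min_def by blast
  have in_m: "r \<in> NE G xb yb m" using equil_at_free_latency_NE[OF valid demand E m] r' by simp
  moreover have "k = m" if rk: "r \<in> NE G xb yb k"
  proof -
    obtain D where E': "equil G xb yb D x y s" and k: "k \<in> {1..roads G}" "free_latency G k \<le> D"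
      "\<forall>j\<in>{1..roads G}. free_latency G j \<le> D \<longrightarrow> j \<le> k"
      using rk unfolding r' NE_iff[OF valid demand] by blast
    have "D = free_latency G m"
      using common_delay_unique equil_imp_nash(2)[OF valid demand E]
        equil_imp_nash(2)[OF valid demand E'] by blast
    then show ?thesis using k m free_latency_le_iff[OF valid k(1) m] by force
  qed
  ultimately show ?thesis by blast
qed

lemma NE_cases_at_m_EQ:
  assumes valid: "valid_network G" and demand: "xb + yb > 0" and mEQ: "m_EQ G xb yb m"
    and r: "(x, y, s) \<in> NE G xb yb m"
  shows "(x, y, s) \<in> BNE G xb yb \<or> s m"
proof -
  obtain D where E: "equil G xb yb D x y s" and m: "m \<in> {1..roads G}" "free_latency G m \<le> D"
    using r unfolding NE_iff[OF valid demand] by blast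
  show ?thesis
  proof (cases "free_latency G m = D")
    case True
    then show ?thesis using E BNE_iff[OF valid demand mEQ] by blast
  next
    case False
    then show ?thesis using E m unfolding equil_def by force
  qed
qed

text \<open>
  The routings in \<open>NE G xb yb m\<close> that are not best equilibria have a congested longest road and thus
  robustness \<open>0\<close>; by \<open>congested_NE_imp_robust_equil\<close> they are never maximizers.
\<close>

lemma arg_max_robustness_iff:
  assumes valid: "valid_network G" and demand: "xb + yb > 0" and nn: "xb \<ge> 0" "yb \<ge> 0"
    and mEQ: "m_EQ G xb yb m"
  shows "is_arg_max (robustness G xb yb m) (\<lambda>r. r \<in> NE G xb yb m) r \<longleftrightarrow>
    is_arg_max (robustness G xb yb m) (\<lambda>r. r \<in> BNE G xb yb) r"
proof -
  have m: "m \<in> {1..roads G}" using mEQ unfolding m_EQ_def is_arg_min_def by blast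
  have sub: "r \<in> NE G xb yb m" if "r \<in> BNE G xb yb" for r
    using NE_of_BNE[OF valid demand mEQ that] by blast
  have pos: "robustness G xb yb m r \<ge> 0" if "r \<in> BNE G xb yb" for r
    using that equil_robustness_nonneg[OF valid demand nn m] BNE_iff[OF valid demand mEQ]
    by (cases r) blast
  have zero: "robustness G xb yb m r = 0 \<and> (\<exists>r'\<in>NE G xb yb m. robustness G xb yb m r' > 0)"
    if "r \<in> NE G xb yb m" "r \<notin> BNE G xb yb" for r
  proof -
    obtain x y s where r: "r = (x, y, s)" by (cases r)
    then have s: "s m" using that NE_cases_at_m_EQ[OF valid demand mEQ] by blast
    have "robustness G xb yb m r = 0" unfolding r using s by (rule robustness_congested)
    then show ?thesis
      using congested_NE_imp_robust_equil[where s = s, OF valid demand nn mEQ _ s] that(1) r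
      by blast
  qed
  show ?thesis
  proof
    assume A: "is_arg_max (robustness G xb yb m) (\<lambda>r. r \<in> NE G xb yb m) r"
    then have "r \<in> BNE G xb yb" using zero[of r] unfolding is_arg_max_def by fastforce
    then show "is_arg_max (robustness G xb yb m) (\<lambda>r. r \<in> BNE G xb yb) r"
      using A sub unfolding is_arg_max_def by blast
  next
    assume A: "is_arg_max (robustness G xb yb m) (\<lambda>r. r \<in> BNE G xb yb) r"
    then show "is_arg_max (robustness G xb yb m) (\<lambda>r. r \<in> NE G xb yb m) r"
      using sub[of r] zero pos[of r] unfolding is_arg_max_def by fastforce
  qed
qed

lemma two_stage_eq_RBNE:
  assumes valid: "valid_network G" and nn: "xb \<ge> 0" "yb \<ge> 0"
  shows "two_stage G xb yb = RBNE G xb yb"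
proof (cases "xb + yb > 0 \<and> (\<exists>m. NE G xb yb m \<noteq> {})")
  case False
  then have "NE G xb yb m = {}" for m using zero_demand_no_NE[OF nn] by blast
  then show ?thesis using two_stage_empty_if_no_NE unfolding RBNE_def by simp
next
  case True
  then have demand: "xb + yb > 0" by blast
  obtain m where mEQ: "m_EQ G xb yb m" using True m_EQ_exists[OF valid] by blast
  have "r \<in> two_stage G xb yb \<longleftrightarrow> r \<in> RBNE G xb yb" for r
  proof -
    have "r \<in> two_stage G xb yb \<longleftrightarrow>
        is_arg_max (robustness G xb yb m) (\<lambda>r. r \<in> BNE G xb yb) r"
      unfolding two_stage_def using mEQ m_EQ_unique[OF valid demand]
        arg_max_robustness_iff[OF valid demand nn] by blast
    also have "\<dots> \<longleftrightarrow> r \<in> RBNE G xb yb"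
    proof -
      have "r \<in> RBNE G xb yb \<longleftrightarrow> r \<in> BNE G xb yb \<and>
          (\<forall>r'\<in>BNE G xb yb. robustness G xb yb m r' \<le> robustness G xb yb m r)"
        unfolding RBNE_def by (auto simp: NE_of_BNE[OF valid demand mEQ])
      then show ?thesis unfolding is_arg_max_def by (meson not_less)
    qed
    finally show ?thesis .
  qed
  then show ?thesis by blast
qed

section \<open>The linear program of a candidate road\<close>

text \<open>
  A solver may report failure only if no optimum exists; this lemma turns such a report into
  infeasibility. Entries of a solution beyond \<open>n\<close> are unconstrained and are set to \<open>0\<close> to make the
  feasible region compact in the product topology.
\<close>

lemma bounded_lp_has_optimum:
  assumes feas: "lp_feasible n k A b z0"
    and bounded: "\<And>z j. lp_feasible n k A b z \<Longrightarrow> j < n \<Longrightarrow> z j \<in> {lo..hi :: real}"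
  shows "\<exists>z. lp_optimal n k A b c z"
proof -
  let ?c = "\<lambda>z :: nat \<Rightarrow> real. \<Sum>j<n. c j * z j"
  define trunc where "trunc z = (\<lambda>j. if j < n then z j else 0)" for z :: "nat \<Rightarrow> real"
  have trunc: "lp_feasible n k A b (trunc z) \<longleftrightarrow> lp_feasible n k A b z" "?c (trunc z) = ?c z" for z
    unfolding lp_feasible_def trunc_def by (auto intro: sum.cong)
  define box where "box = (PiE UNIV (\<lambda>j. if j < n then {lo..hi} else {0}) :: (nat \<Rightarrow> real) set)"
  have "compact box"
  proof -
    have "compactin (product_topology (\<lambda>i :: nat. euclidean :: real topology) UNIV) box"
      unfolding box_def compactin_PiE by auto
    then show ?thesis by (simp add: euclidean_product_topology)
  qed
  moreover have "closed {z. lp_feasible n k A b z}"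
    unfolding lp_feasible_def
    by (intro closed_Collect_all closed_Collect_imp closed_Collect_le continuous_intros
        continuous_on_product_coordinates) auto
  ultimately have compact: "compact (box \<inter> {z. lp_feasible n k A b z})"
    by (rule compact_Int_closed)
  have in_box: "trunc z \<in> box" if "lp_feasible n k A b z" for z
    using bounded[OF that] by (auto simp: box_def trunc_def)
  have nonempty: "box \<inter> {z. lp_feasible n k A b z} \<noteq> {}"
    using in_box[OF feas] feas trunc(1) by blast
  have "continuous_on (box \<inter> {z. lp_feasible n k A b z}) ?c"
    by (rule continuous_on_subset[OF _ subset_UNIV])
      (intro continuous_intros continuous_on_product_coordinates)
  from continuous_attains_sup[OF compact nonempty this]
  obtain z where z: "lp_feasible n k A b z"
    "\<And>w. w \<in> box \<Longrightarrow> lp_feasible n k A b w \<Longrightarrow> ?c w \<le> ?c z"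
    by blast
  have "?c w \<le> ?c z" if "lp_feasible n k A b w" for w
    using z(2)[of "trunc w"] in_box[OF that] that trunc by simp
  then have "lp_optimal n k A b c z"
    using z(1) unfolding lp_optimal_def is_arg_max_def by (auto simp: not_less)
  then show ?thesis by blast
qed

text \<open>
  Variable \<open>i < N\<close> is the human-driven flow on road \<open>i + 1\<close>, variable \<open>N + i\<close> the autonomous flow
  on it. With \<open>h\<close> and \<open>a\<close> the loads of unit flows, the blocks of rows say: loads are bounded above;
  loads are bounded below; flows are nonnegative; and, as two inequalities each, both demands are
  met exactly. The case distinctions are arranged as the program below performs them.
\<close>

definition lp_matrix :: "nat \<Rightarrow> (nat \<Rightarrow> real) \<Rightarrow> (nat \<Rightarrow> real) \<Rightarrow> nat \<Rightarrow> nat \<Rightarrow> real" where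
  "lp_matrix N h a r j =
    (if r < N then if j = r then h r else if j = N + r then a r else 0
     else if r < N + N then
       if j + N = r then - h j else if j = r then - a (j - N) else 0
     else if r < N + N + (N + N) then if N + N + j = r then -1 else 0
     else if r < N + N + (N + N) + 1 then if j < N then 1 else 0
     else if r < N + N + (N + N) + 2 then if j < N then -1 else 0
     else if r < N + N + (N + N) + 3 then if j < N then 0 else 1
     else if j < N then 0 else -1)"

text \<open>
  Roads before \<open>m\<close> have load exactly \<open>1\<close>, road \<open>m\<close> at most \<open>1\<close> and later roads \<open>0\<close>, which for
  nonnegative flows means that they are empty. Row \<open>i\<close> belongs to road \<open>i + 1\<close>.
\<close>

definition lp_bound :: "nat \<Rightarrow> nat \<Rightarrow> real \<Rightarrow> real \<Rightarrow> nat \<Rightarrow> real" where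
  "lp_bound N m xb yb r =
    (if r < N then if r < m then 1 else 0
     else if r < N + N then if r + 1 < N + m then -1 else 0
     else if r < N + N + (N + N) then 0
     else if r < N + N + (N + N) + 1 then xb
     else if r < N + N + (N + N) + 2 then - xb
     else if r < N + N + (N + N) + 3 then yb
     else - yb)"

text \<open>
  The objective is the negated load of road \<open>m\<close>. By \<open>robustness_eq\<close> the robustness is an increasing
  affine function of it, with coefficients that are the same for all routings.
\<close>

definition lp_objective :: "nat \<Rightarrow> nat \<Rightarrow> (nat \<Rightarrow> real) \<Rightarrow> (nat \<Rightarrow> real) \<Rightarrow> nat \<Rightarrow> real" where
  "lp_objective N m h a j =
    (if j + 1 = m then - h j else if j + 1 = N + m then - a (j - N) else 0)"

lemma all_less_add: "(\<forall>r < p + q. P r) \<longleftrightarrow> (\<forall>r < p. P r) \<and> (\<forall>r < q. P (p + r))" for p q :: nat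
proof (safe)
  fix r assume "\<forall>r<p. P r" "\<forall>r<q. P (p + r)" "r < p + q"
  then show "P r" by (cases "r < p") (auto dest: spec[of _ "r - p"])
qed auto

lemma sum_lessThan_add:
  "(\<Sum>j < p + q. f j) = (\<Sum>j < p. f j) + (\<Sum>j < q. f (p + j))"
  for f :: "nat \<Rightarrow> 'a :: comm_monoid_add"
  by (induction q) (simp_all add: add.assoc)

abbreviation lp_rows :: "nat \<Rightarrow> nat" where
  "lp_rows N \<equiv> N + N + (N + N) + 4"

lemma lp_row_values:
  fixes N :: nat and h a z :: "nat \<Rightarrow> real"
  defines "row \<equiv> \<lambda>r. \<Sum>j < N + N. lp_matrix N h a r j * z j"
  shows "i < N \<Longrightarrow> row i = h i * z i + a i * z (N + i)"
    and "i < N \<Longrightarrow> row (N + i) = - (h i * z i + a i * z (N + i))"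
    and "i < N + N \<Longrightarrow> row (N + N + i) = - z i"
    and "row (N + N + (N + N)) = (\<Sum>i<N. z i)"
    and "row (N + N + (N + N) + 1) = - (\<Sum>i<N. z i)"
    and "row (N + N + (N + N) + 2) = (\<Sum>i<N. z (N + i))"
    and "row (N + N + (N + N) + 3) = - (\<Sum>i<N. z (N + i))"
proof -
  have single: "(\<Sum>j<p. (if j = i then g j else 0) * w j) = g i * w i" if "i < p"
    for p i and g w :: "nat \<Rightarrow> real"
  proof -
    have "(\<Sum>j<p. (if j = i then g j else 0) * w j) = (\<Sum>j<p. if j = i then g j * w j else 0)"
      by (intro sum.cong) auto
    then show ?thesis using that by simp
  qed
  show "row i = h i * z i + a i * z (N + i)" if "i < N"
  proof -
    have "row i = (\<Sum>j<N. (if j = i then h j else 0) * z j)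
        + (\<Sum>j<N. (if j = i then a j else 0) * z (N + j))"
      unfolding row_def sum_lessThan_add using that
      by (intro arg_cong2[where f = "(+)"] sum.cong) (auto simp: lp_matrix_def)
    then show ?thesis using that by (simp add: single)
  qed
  show "row (N + i) = - (h i * z i + a i * z (N + i))" if "i < N"
  proof -
    have "row (N + i) = (\<Sum>j<N. (if j = i then - h j else 0) * z j)
        + (\<Sum>j<N. (if j = i then - a j else 0) * z (N + j))"
      unfolding row_def sum_lessThan_add using that
      by (intro arg_cong2[where f = "(+)"] sum.cong) (auto simp: lp_matrix_def)
    then show ?thesis using that by (simp add: single)
  qed
  show "row (N + N + i) = - z i" if "i < N + N"
  proof -
    have "row (N + N + i) = (\<Sum>j<N + N. (if j = i then -1 else 0) * z j)"
      unfolding row_def using that by (intro sum.cong) (auto simp: lp_matrix_def)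
    then show ?thesis using that by (simp add: single)
  qed
  show "row (N + N + (N + N)) = (\<Sum>i<N. z i)"
    "row (N + N + (N + N) + 1) = - (\<Sum>i<N. z i)"
    "row (N + N + (N + N) + 2) = (\<Sum>i<N. z (N + i))"
    "row (N + N + (N + N) + 3) = - (\<Sum>i<N. z (N + i))"
    unfolding row_def sum_lessThan_add by (simp_all add: lp_matrix_def sum_negf)
qed

lemma lp_feasible_routing_iff:
  fixes z :: "nat \<Rightarrow> real"
  shows "lp_feasible (N + N) (lp_rows N) (lp_matrix N h a) (lp_bound N m xb yb) z \<longleftrightarrow>
    (\<forall>i<N. h i * z i + a i * z (N + i) \<le> (if i < m then 1 else 0)) \<and>
    (\<forall>i<N. h i * z i + a i * z (N + i) \<ge> (if i + 1 < m then 1 else 0)) \<and>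
    (\<forall>i<N. z i \<ge> 0 \<and> z (N + i) \<ge> 0) \<and>
    (\<Sum>i<N. z i) = xb \<and> (\<Sum>i<N. z (N + i)) = yb"
proof -
  let ?P = "\<lambda>r. (\<Sum>j < N + N. lp_matrix N h a r j * z j) \<le> lp_bound N m xb yb r"
  let ?R = "N + N + (N + N)"
  have four: "(\<forall>r<4. Q r) \<longleftrightarrow> Q 0 \<and> Q 1 \<and> Q 2 \<and> Q 3" for Q :: "nat \<Rightarrow> bool"
    by (simp add: numeral_eq_Suc All_less_Suc One_nat_def) blast
  have "lp_feasible (N + N) (lp_rows N) (lp_matrix N h a) (lp_bound N m xb yb) z \<longleftrightarrow>
      (\<forall>i<N. ?P i) \<and> (\<forall>i<N. ?P (N + i)) \<and> (\<forall>i<N + N. ?P (N + N + i)) \<and>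
      ?P (?R + 0) \<and> ?P (?R + 1) \<and> ?P (?R + 2) \<and> ?P (?R + 3)"
    unfolding lp_feasible_def all_less_add[of ?R 4] four all_less_add[of "N + N" "N + N"]
      all_less_add[of N N ?P] by blast
  also have "(\<forall>i<N. ?P i) \<longleftrightarrow>
      (\<forall>i<N. h i * z i + a i * z (N + i) \<le> (if i < m then 1 else 0))"
    by (simp add: lp_row_values lp_bound_def)
  also have "(\<forall>i<N. ?P (N + i)) \<longleftrightarrow>
      (\<forall>i<N. h i * z i + a i * z (N + i) \<ge> (if i + 1 < m then 1 else 0))"
    by (auto simp: lp_row_values lp_bound_def)
  also have "(\<forall>i<N + N. ?P (N + N + i)) \<longleftrightarrow> (\<forall>i<N + N. z i \<ge> 0)"
    by (simp add: lp_row_values lp_bound_def)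
  also have "\<dots> \<longleftrightarrow> (\<forall>i<N. z i \<ge> 0 \<and> z (N + i) \<ge> 0)"
    unfolding all_less_add by blast
  also have "?P (?R + 0) \<and> ?P (?R + 1) \<and> ?P (?R + 2) \<and> ?P (?R + 3) \<longleftrightarrow>
      (\<Sum>i<N. z i) = xb \<and> (\<Sum>i<N. z (N + i)) = yb"
    unfolding add_0_right lp_row_values by (auto simp: lp_bound_def)
  finally show ?thesis .
qed

lemma lp_objective_value:
  fixes z :: "nat \<Rightarrow> real"
  assumes "m \<in> {1..N}"
  shows "(\<Sum>j < N + N. lp_objective N m h a j * z j)
    = - (h (m - 1) * z (m - 1) + a (m - 1) * z (N + (m - 1)))"
proof -
  have "(\<Sum>j < N + N. lp_objective N m h a j * z j)
      = (\<Sum>j<N. if j = m - 1 then - h j * z j else 0)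
      + (\<Sum>j<N. if j = m - 1 then - a j * z (N + j) else 0)"
    unfolding sum_lessThan_add using assms
    by (intro arg_cong2[where f = "(+)"] sum.cong) (auto simp: lp_objective_def)
  moreover have "m - 1 < N" using assms by auto
  ultimately show ?thesis by simp
qed

abbreviation human_row :: "network \<Rightarrow> nat \<Rightarrow> nat \<Rightarrow> real" where
  "human_row G m i \<equiv> human_load G (free_latency G m) (Suc i)"
abbreviation av_row :: "network \<Rightarrow> nat \<Rightarrow> nat \<Rightarrow> real" where
  "av_row G m i \<equiv> av_load G (free_latency G m) (Suc i)"

definition equil_lp_feasible :: "network \<Rightarrow> real \<Rightarrow> real \<Rightarrow> nat \<Rightarrow> (nat \<Rightarrow> real) \<Rightarrow> bool" where
  "equil_lp_feasible G xb yb m = lp_feasible (roads G + roads G) (lp_rows (roads G))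
     (lp_matrix (roads G) (human_row G m) (av_row G m)) (lp_bound (roads G) m xb yb)"

definition equil_lp_optimal :: "network \<Rightarrow> real \<Rightarrow> real \<Rightarrow> nat \<Rightarrow> (nat \<Rightarrow> real) \<Rightarrow> bool" where
  "equil_lp_optimal G xb yb m = lp_optimal (roads G + roads G) (lp_rows (roads G))
     (lp_matrix (roads G) (human_row G m) (av_row G m)) (lp_bound (roads G) m xb yb)
     (lp_objective (roads G) m (human_row G m) (av_row G m))"

lemma all_roads_shift: "(\<forall>i\<in>{1..N}. P i) \<longleftrightarrow> (\<forall>i<N. P (Suc i))" for N :: nat
proof safe
  fix i assume "\<forall>i<N. P (Suc i)" "i \<in> {1..N}"
  then show "P i" by (cases i) auto
qed (auto simp: One_nat_def)

lemma sum_roads_shift: "(\<Sum>i\<in>{1..N}. f i) = (\<Sum>i<N. f (Suc i))" for N :: nat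
  by (simp add: One_nat_def sum.atLeast1_atMost_eq)

lemma equil_lp_feasible_iff:
  assumes valid: "valid_network G" and m: "m \<in> {1..roads G}"
  shows "equil_lp_feasible G xb yb m z \<longleftrightarrow>
    equil G xb yb (free_latency G m) (\<lambda>i. z (i - 1)) (\<lambda>i. z (roads G + (i - 1))) (\<lambda>i. i < m)"
proof -
  let ?N = "roads G" and ?D = "free_latency G m"
  let ?x = "\<lambda>i. z (i - 1)" and ?y = "\<lambda>i. z (?N + (i - 1))"
  have order: "(i < m \<longleftrightarrow> free_latency G i < ?D)" "free_latency G i = ?D \<longleftrightarrow> i = m"
      "free_latency G i > ?D \<longleftrightarrow> i > m"
    if "i \<in> {1..?N}" for i
    using free_latency_less_iff[OF valid that m] free_latency_less_iff[OF valid m that] by force+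
  have rows: "(load G ?D i (?x i) (?y i) \<le> (if i \<le> m then 1 else 0) \<and>
        load G ?D i (?x i) (?y i) \<ge> (if i < m then 1 else 0) \<and> ?x i \<ge> 0 \<and> ?y i \<ge> 0) \<longleftrightarrow>
      (?x i \<ge> 0 \<and> ?y i \<ge> 0 \<and> (i < m \<longleftrightarrow> free_latency G i < ?D) \<and>
        (free_latency G i < ?D \<longrightarrow> load G ?D i (?x i) (?y i) = 1) \<and>
        (free_latency G i = ?D \<longrightarrow> load G ?D i (?x i) (?y i) \<le> 1) \<and>
        (free_latency G i > ?D \<longrightarrow> ?x i + ?y i = 0))"
    if i: "i \<in> {1..?N}" for i
  proof (cases "?x i \<ge> 0 \<and> ?y i \<ge> 0")
    case True
    then have "load G ?D i (?x i) (?y i) \<ge> 0" using load_nonneg[OF valid i] by simp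
    moreover have "load G ?D i (?x i) (?y i) \<le> 0 \<longleftrightarrow> ?x i + ?y i = 0"
    proof
      assume "load G ?D i (?x i) (?y i) \<le> 0"
      then show "?x i + ?y i = 0" using True load_pos[OF valid i, of "?x i" "?y i" ?D] by linarith
    next
      assume "?x i + ?y i = 0"
      then have "?x i = 0" "?y i = 0" using True by linarith+
      then show "load G ?D i (?x i) (?y i) \<le> 0" by (simp add: load_def)
    qed
    ultimately show ?thesis using True order[OF i] by force
  qed blast
  have "equil_lp_feasible G xb yb m z \<longleftrightarrow>
      (\<forall>i\<in>{1..?N}. load G ?D i (?x i) (?y i) \<le> (if i \<le> m then 1 else 0) \<and>
        load G ?D i (?x i) (?y i) \<ge> (if i < m then 1 else 0) \<and> ?x i \<ge> 0 \<and> ?y i \<ge> 0) \<and>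
      (\<Sum>i\<in>{1..?N}. ?x i) = xb \<and> (\<Sum>i\<in>{1..?N}. ?y i) = yb"
    unfolding equil_lp_feasible_def lp_feasible_routing_iff all_roads_shift sum_roads_shift load_def
      diff_Suc_1 Suc_le_eq Suc_eq_plus1[symmetric]
    by blast
  also have "\<dots> \<longleftrightarrow> equil G xb yb ?D ?x ?y (\<lambda>i. i < m)"
    unfolding equil_def using rows by auto
  finally show ?thesis .
qed

lemma equil_cong:
  assumes "\<And>i. i \<in> {1..roads G} \<Longrightarrow> x i = x' i \<and> y i = y' i \<and> s i = s' i"
  shows "equil G xb yb D x y s \<longleftrightarrow> equil G xb yb D x' y' s'"
proof -
  have "(\<Sum>i\<in>{1..roads G}. x i) = (\<Sum>i\<in>{1..roads G}. x' i)"
    "(\<Sum>i\<in>{1..roads G}. y i) = (\<Sum>i\<in>{1..roads G}. y' i)"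
    using assms by (auto intro: sum.cong)
  then show ?thesis unfolding equil_def using assms by simp
qed

lemma equil_lp_feasible_of_equil:
  assumes valid: "valid_network G" and m: "m \<in> {1..roads G}"
    and E: "equil G xb yb (free_latency G m) x y s"
  shows "equil_lp_feasible G xb yb m
    (\<lambda>j. if j < roads G then x (j + 1) else y (j - roads G + 1))" (is "equil_lp_feasible _ _ _ _ ?z")
proof -
  have "s i \<longleftrightarrow> i < m" if "i \<in> {1..roads G}" for i
    using E that free_latency_less_iff[OF valid that m] unfolding equil_def by blast
  then have "equil G xb yb (free_latency G m) (\<lambda>i. ?z (i - 1)) (\<lambda>i. ?z (roads G + (i - 1))) (\<lambda>i. i < m)
      \<longleftrightarrow> equil G xb yb (free_latency G m) x y s"
    by (intro equil_cong) auto
  then show ?thesis using E equil_lp_feasible_iff[OF valid m] by simp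
qed

lemma equil_lp_optimum_exists:
  assumes valid: "valid_network G" and m: "m \<in> {1..roads G}"
    and F: "equil_lp_feasible G xb yb m z0"
  shows "\<exists>z. equil_lp_optimal G xb yb m z"
  unfolding equil_lp_optimal_def
proof (rule bounded_lp_has_optimum)
  show "lp_feasible (roads G + roads G) (lp_rows (roads G))
     (lp_matrix (roads G) (human_row G m) (av_row G m)) (lp_bound (roads G) m xb yb) z0"
    using F unfolding equil_lp_feasible_def .
next
  fix z j
  assume "lp_feasible (roads G + roads G) (lp_rows (roads G))
     (lp_matrix (roads G) (human_row G m) (av_row G m)) (lp_bound (roads G) m xb yb) z"
    and j: "j < roads G + roads G"
  then have nn: "\<forall>i<roads G. z i \<ge> 0 \<and> z (roads G + i) \<ge> 0"
    and "(\<Sum>i<roads G. z i) = xb" "(\<Sum>i<roads G. z (roads G + i)) = yb"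
    unfolding lp_feasible_routing_iff by auto
  then have total: "(\<Sum>i<roads G + roads G. z i) = xb + yb" by (simp add: sum_lessThan_add)
  have "\<forall>i<roads G + roads G. z i \<ge> 0" using nn unfolding all_less_add by blast
  then show "z j \<in> {0..xb + yb}"
    using j member_le_sum[of j "{..<roads G + roads G}" z] total by auto
qed

text \<open>
  Maximality has to compare with every equilibrium whose longest road is \<open>m\<close>; by
  \<open>arg_max_robustness_iff\<close> it suffices to compare with those of delay \<open>free_latency G m\<close>, which are
  the feasible points. The routing is given on the roads only, because that is all a program can write.
\<close>

lemma equil_lp_optimal_imp_robust:
  assumes valid: "valid_network G" and demand: "xb + yb > 0" and nn: "xb \<ge> 0" "yb \<ge> 0"
    and mEQ: "m_EQ G xb yb m" and O: "equil_lp_optimal G xb yb m z"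
    and out: "\<And>i. i \<in> {1..roads G} \<Longrightarrow>
      x i = z (i - 1) \<and> y i = z (roads G + (i - 1)) \<and> s i = (i < m)"
  shows "is_arg_max (robustness G xb yb m) (\<lambda>r. r \<in> NE G xb yb m) (x, y, s)"
  unfolding arg_max_robustness_iff[OF valid demand nn mEQ]
proof -
  let ?D = "free_latency G m"
  have m: "m \<in> {1..roads G}" using mEQ unfolding m_EQ_def is_arg_min_def by blast
  have obj: "(\<Sum>j < roads G + roads G. lp_objective (roads G) m (human_row G m) (av_row G m) j * w j)
      = - load G ?D m (w (m - 1)) (w (roads G + (m - 1)))" for w
    unfolding lp_objective_value[OF m] load_def using m by simp
  have F: "equil_lp_feasible G xb yb m z"
    and max: "\<And>w. equil_lp_feasible G xb yb m w \<Longrightarrow>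
      load G ?D m (x m) (y m) \<le> load G ?D m (w (m - 1)) (w (roads G + (m - 1)))"
    using O out[OF m]
    unfolding equil_lp_optimal_def equil_lp_feasible_def lp_optimal_def is_arg_max_def obj
    by (auto simp: not_less)
  have "equil G xb yb ?D (\<lambda>i. z (i - 1)) (\<lambda>i. z (roads G + (i - 1))) (\<lambda>i. i < m)"
    using F equil_lp_feasible_iff[OF valid m] by blast
  moreover have "equil G xb yb ?D x y s \<longleftrightarrow>
      equil G xb yb ?D (\<lambda>i. z (i - 1)) (\<lambda>i. z (roads G + (i - 1))) (\<lambda>i. i < m)"
    by (intro equil_cong out)
  ultimately have E: "equil G xb yb ?D x y s" by blast
  have pos: "load G ?D m xb yb > 0" using load_pos[OF valid m nn demand] .
  have "robustness G xb yb m (x', y', s') \<le> robustness G xb yb m (x, y, s)"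
    if E': "equil G xb yb ?D x' y' s'" for x' y' s'
  proof -
    let ?w = "\<lambda>j. if j < roads G then x' (j + 1) else y' (j - roads G + 1)"
    have "load G ?D m (x m) (y m) \<le> load G ?D m (?w (m - 1)) (?w (roads G + (m - 1)))"
      using max equil_lp_feasible_of_equil[OF valid m E'] by blast
    moreover have "?w (m - 1) = x' m" "?w (roads G + (m - 1)) = y' m" using m by auto
    ultimately have "load G ?D m (x m) (y m) \<le> load G ?D m (x' m) (y' m)" by (simp only:)
    then show ?thesis
      unfolding robustness_eq[OF valid demand E m nn] robustness_eq[OF valid demand E' m nn]
      using pos by (simp add: divide_right_mono)
  qed
  then show "is_arg_max (robustness G xb yb m) (\<lambda>r. r \<in> BNE G xb yb) (x, y, s)"
    using E BNE_iff[OF valid demand mEQ] unfolding is_arg_max_def by (auto simp: not_less)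
qed

section \<open>Running programs within a time bound\<close>

definition runs :: "lp_solver \<Rightarrow> com \<Rightarrow> store \<Rightarrow> nat \<Rightarrow> (store \<Rightarrow> bool) \<Rightarrow> bool" where
  "runs solve p \<sigma> B Q \<longleftrightarrow> (\<exists>t \<tau>. exec solve p \<sigma> t \<tau> \<and> t \<le> B \<and> Q \<tau>)"

lemma runs_weaken:
  assumes "runs solve p \<sigma> B Q" "B \<le> B'" "\<And>\<tau>. Q \<tau> \<Longrightarrow> Q' \<tau>"
  shows "runs solve p \<sigma> B' Q'"
  using assms unfolding runs_def by (meson le_trans)

lemma runs_Seq:
  assumes "runs solve p \<sigma> B Q" "\<And>\<tau>. Q \<tau> \<Longrightarrow> runs solve q \<tau> B' R"
  shows "runs solve (Seq p q) \<sigma> (B + B') R"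
  using assms unfolding runs_def by (meson add_mono exec.Seq)

lemma runs_NAssign: "Q (set_nat v (nval \<sigma> e) \<sigma>) \<Longrightarrow> runs solve (NAssign v e) \<sigma> 1 Q"
  unfolding runs_def using exec.NAssign by blast

lemma runs_Cond:
  assumes "tval \<sigma> b \<Longrightarrow> runs solve p \<sigma> B Q" "\<not> tval \<sigma> b \<Longrightarrow> runs solve q \<sigma> B Q"
  shows "runs solve (Cond b p q) \<sigma> (1 + B) Q"
  using assms unfolding runs_def by (meson add_le_cancel_left exec.CondTrue exec.CondFalse)

lemma runs_While_done: "\<not> tval \<sigma> b \<Longrightarrow> Q \<sigma> \<Longrightarrow> runs solve (While b p) \<sigma> 1 Q"
  unfolding runs_def using exec.WhileFalse by blast

lemma runs_While_step:
  assumes "tval \<sigma> b" "runs solve p \<sigma> B R" "\<And>\<tau>. R \<tau> \<Longrightarrow> runs solve (While b p) \<tau> B' Q"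
  shows "runs solve (While b p) \<sigma> (1 + B + B') Q"
  using assms unfolding runs_def by (meson add_mono exec.WhileTrue order_refl)

lemma runs_SolveLP:
  "Q (lp_step solve (nval \<sigma> en) (nval \<sigma> ek) A b c z flag \<sigma>) \<Longrightarrow>
    runs solve (SolveLP en ek A b c z flag) \<sigma> (1 + (nval \<sigma> en + nval \<sigma> ek) ^ 3) Q"
  unfolding runs_def using exec.SolveLP by blast

lemma nats_set_nat [simp]: "nats (set_nat v k \<sigma>) u = (if u = v then k else nats \<sigma> u)"
  and reals_set_nat [simp]: "reals (set_nat v k \<sigma>) = reals \<sigma>"
  and nats_set_cell [simp]: "nats (set_cell v i j a \<sigma>) = nats \<sigma>"
  and reals_set_cell: "reals (set_cell v i j a \<sigma>) u i' j' =
    (if u = v \<and> i' = i \<and> j' = j then a else reals \<sigma> u i' j')"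
  and reals_set_cell_other [simp]: "u \<noteq> v \<Longrightarrow> reals (set_cell v i j a \<sigma>) u = reals \<sigma> u"
  by (simp_all add: set_nat_def set_cell_def)

definition count_loop :: "vname \<Rightarrow> nexp \<Rightarrow> com \<Rightarrow> com" where
  "count_loop v e p = Seq (NAssign v (NConst 0))
     (While (NLess (NVar v) e) (Seq p (NAssign v (NAdd (NVar v) (NConst 1)))))"

lemma runs_count_loop:
  assumes start: "I 0 (set_nat v 0 \<sigma>)"
    and bound: "\<And>i \<tau>. I i \<tau> \<Longrightarrow> nats \<tau> v = i \<and> nval \<tau> e = n"
    and step: "\<And>i \<tau>. i < n \<Longrightarrow> I i \<tau> \<Longrightarrow>
      runs solve p \<tau> B (\<lambda>\<tau>'. nats \<tau>' v = i \<and> I (Suc i) (set_nat v (Suc i) \<tau>'))"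
  shows "runs solve (count_loop v e p) \<sigma> (2 + n * (B + 2)) (I n)"
proof -
  let ?w = "While (NLess (NVar v) e) (Seq p (NAssign v (NAdd (NVar v) (NConst 1))))"
  have loop: "runs solve ?w \<tau> (1 + k * (B + 2)) (I n)" if "k \<le> n" "I (n - k) \<tau>" for k \<tau>
    using that
  proof (induction k arbitrary: \<tau>)
    case 0
    then show ?case using bound[of n] by (auto intro!: runs_While_done)
  next
    case (Suc k)
    then have lt: "n - Suc k < n" and next_i: "Suc (n - Suc k) = n - k" "n - Suc k + 1 = n - k" by auto
    have body: "runs solve (Seq p (NAssign v (NAdd (NVar v) (NConst 1)))) \<tau> (B + 1) (I (n - k))"
      by (rule runs_Seq[OF step[OF lt Suc.prems(2)]]) (auto intro!: runs_NAssign simp: next_i)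
    have "runs solve ?w \<tau> (1 + (B + 1) + (1 + k * (B + 2))) (I n)"
      using bound[OF Suc.prems(2)] lt Suc.IH Suc.prems(1)
      by (intro runs_While_step[OF _ body]) auto
    then show ?case by (rule runs_weaken) auto
  qed
  have "runs solve (count_loop v e p) \<sigma> (1 + (1 + n * (B + 2))) (I n)"
    unfolding count_loop_def
  proof (rule runs_Seq)
    show "runs solve (NAssign v (NConst 0)) \<sigma> 1 (I 0)"
      using start by (intro runs_NAssign) simp
    show "\<And>\<tau>. I 0 \<tau> \<Longrightarrow> runs solve ?w \<tau> (1 + n * (B + 2)) (I n)"
      using loop[of n] by simp
  qed
  then show ?thesis by (rule runs_weaken) simp_all
qed

text \<open>
  The decision trees that compute single array entries. Such expressions cover all work of the
  program apart from the calls of the solver and one search loop.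
\<close>

datatype cell = Leaf rexp | Split test cell cell

fun cell_val :: "store \<Rightarrow> cell \<Rightarrow> real" where
  "cell_val \<sigma> (Leaf e) = rval \<sigma> e"
| "cell_val \<sigma> (Split b p q) = (if tval \<sigma> b then cell_val \<sigma> p else cell_val \<sigma> q)"

fun cell_cost :: "cell \<Rightarrow> nat" where
  "cell_cost (Leaf e) = 1"
| "cell_cost (Split b p q) = 1 + max (cell_cost p) (cell_cost q)"

fun assign_cell :: "vname \<Rightarrow> nexp \<Rightarrow> nexp \<Rightarrow> cell \<Rightarrow> com" where
  "assign_cell v i j (Leaf e) = RAssign v i j e"
| "assign_cell v i j (Split b p q) = Cond b (assign_cell v i j p) (assign_cell v i j q)"

lemma runs_assign_cell:
  "Q (set_cell v (nval \<sigma> i) (nval \<sigma> j) (cell_val \<sigma> c) \<sigma>) \<Longrightarrow>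
    runs solve (assign_cell v i j c) \<sigma> (cell_cost c) Q"
proof (induction c)
  case (Leaf e)
  then show ?case unfolding runs_def using exec.RAssign[of solve v i j e \<sigma>] by auto
next
  case (Split b p q)
  have "runs solve (Cond b (assign_cell v i j p) (assign_cell v i j q)) \<sigma>
      (1 + max (cell_cost p) (cell_cost q)) Q"
  proof (rule runs_Cond)
    assume "tval \<sigma> b"
    then show "runs solve (assign_cell v i j p) \<sigma> (max (cell_cost p) (cell_cost q)) Q"
      using Split by (intro runs_weaken[OF Split.IH(1)]) auto
  next
    assume "\<not> tval \<sigma> b"
    then show "runs solve (assign_cell v i j q) \<sigma> (max (cell_cost p) (cell_cost q)) Q"
      using Split by (intro runs_weaken[OF Split.IH(2)]) auto
  qed
  then show ?case by simp
qed

definition fill :: "vname \<Rightarrow> nexp \<Rightarrow> nexp \<Rightarrow> cell \<Rightarrow> com" where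
  "fill v ek en c = count_loop ''r'' ek
     (count_loop ''j'' en (assign_cell v (NVar ''r'') (NVar ''j'') c))"

definition fill_cost :: "nat \<Rightarrow> nat \<Rightarrow> nat \<Rightarrow> nat" where
  "fill_cost a k n = 2 + k * (2 + n * (a + 2) + 2)"

text \<open>
  What \<open>fill v\<close> leaves unchanged: everything but the array \<open>v\<close> and the two loop counters.
\<close>

definition framed :: "vname \<Rightarrow> store \<Rightarrow> store \<Rightarrow> bool" where
  "framed v \<sigma> \<tau> \<longleftrightarrow> (\<forall>u. u \<noteq> ''r'' \<and> u \<noteq> ''j'' \<longrightarrow> nats \<tau> u = nats \<sigma> u) \<and>
     (\<forall>u. u \<noteq> v \<longrightarrow> reals \<tau> u = reals \<sigma> u)"

text \<open>
  The entry expression must have the intended value in every state that occurs while the array is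
  being filled; as \<open>framed\<close> hides the array itself, this rules out expressions that depend on
  entries already written.
\<close>

lemma runs_fill:
  assumes ek: "\<And>\<tau>. framed v \<sigma> \<tau> \<Longrightarrow> nval \<tau> ek = k"
    and en: "\<And>\<tau>. framed v \<sigma> \<tau> \<Longrightarrow> nval \<tau> en = n"
    and val: "\<And>\<tau>. framed v \<sigma> \<tau> \<Longrightarrow> nats \<tau> ''r'' < k \<Longrightarrow> nats \<tau> ''j'' < n \<Longrightarrow>
      cell_val \<tau> c = f (nats \<tau> ''r'') (nats \<tau> ''j'')"
  shows "runs solve (fill v ek en c) \<sigma> (fill_cost (cell_cost c) k n)
    (\<lambda>\<tau>. framed v \<sigma> \<tau> \<and> (\<forall>i<k. \<forall>j<n. reals \<tau> v i j = f i j))"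
proof -
  define I where "I i \<tau> \<longleftrightarrow> framed v \<sigma> \<tau> \<and> nats \<tau> ''r'' = i \<and>
    (\<forall>i'<i. \<forall>j<n. reals \<tau> v i' j = f i' j)" for i \<tau>
  define J where "J i j \<tau> \<longleftrightarrow> I i \<tau> \<and> nats \<tau> ''j'' = j \<and> (\<forall>j'<j. reals \<tau> v i j' = f i j')"
    for i j \<tau>
  have row: "runs solve (count_loop ''j'' en (assign_cell v (NVar ''r'') (NVar ''j'') c)) \<tau>
      (2 + n * (cell_cost c + 2)) (J i n)" if "i < k" "I i \<tau>" for i \<tau>
  proof (rule runs_count_loop)
    show "J i 0 (set_nat ''j'' 0 \<tau>)"
      using that by (simp add: J_def I_def framed_def)
    show "nats \<tau> ''j'' = j \<and> nval \<tau> en = n" if "J i j \<tau>" for j \<tau>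
      using that en unfolding J_def I_def by blast
    fix j \<tau>' assume j: "j < n" "J i j \<tau>'"
    then have *: "framed v \<sigma> \<tau>'" "nats \<tau>' ''r'' = i" "nats \<tau>' ''j'' = j"
      unfolding J_def I_def by auto
    have "cell_val \<tau>' c = f i j" using val[OF *(1)] * j(1) \<open>i < k\<close> by simp
    then show "runs solve (assign_cell v (NVar ''r'') (NVar ''j'') c) \<tau>' (cell_cost c)
        (\<lambda>\<tau>''. nats \<tau>'' ''j'' = j \<and> J i (Suc j) (set_nat ''j'' (Suc j) \<tau>''))"
      using j * by (intro runs_assign_cell)
        (auto simp: J_def I_def framed_def reals_set_cell less_Suc_eq)
  qed
  have "runs solve (fill v ek en c) \<sigma> (2 + k * (2 + n * (cell_cost c + 2) + 2)) (I k)"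
    unfolding fill_def
  proof (rule runs_count_loop)
    show "I 0 (set_nat ''r'' 0 \<sigma>)" by (simp add: I_def framed_def)
    show "nats \<tau> ''r'' = i \<and> nval \<tau> ek = k" if "I i \<tau>" for i \<tau>
      using that ek unfolding I_def by blast
    fix i \<tau> assume i: "i < k" "I i \<tau>"
    show "runs solve (count_loop ''j'' en (assign_cell v (NVar ''r'') (NVar ''j'') c)) \<tau>
        (2 + n * (cell_cost c + 2))
        (\<lambda>\<tau>'. nats \<tau>' ''r'' = i \<and> I (Suc i) (set_nat ''r'' (Suc i) \<tau>'))"
      by (rule runs_weaken[OF row[OF i]]) (auto simp: J_def I_def framed_def less_Suc_eq)
  qed
  then show ?thesis unfolding fill_cost_def
    by (rule runs_weaken) (auto simp: I_def)
qed

text \<open>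
  Memory outside the filled region is arbitrary, so the solver receives the intended program only up
  to the entries that matter.
\<close>

lemma lp_feasible_cong:
  assumes "\<And>i j. i < k \<Longrightarrow> j < n \<Longrightarrow> A i j = A' i j" "\<And>i. i < k \<Longrightarrow> b i = b' i"
    "\<And>j. j < n \<Longrightarrow> z j = z' j"
  shows "lp_feasible n k A b z \<longleftrightarrow> lp_feasible n k A' b' z'"
proof -
  have "(\<Sum>j<n. A i j * z j) = (\<Sum>j<n. A' i j * z' j)" if "i < k" for i
    using assms that by (intro sum.cong) auto
  then show ?thesis using assms(2) by (simp add: lp_feasible_def)
qed

lemma lp_optimal_cong:
  assumes "\<And>i j. i < k \<Longrightarrow> j < n \<Longrightarrow> A i j = A' i j" "\<And>i. i < k \<Longrightarrow> b i = b' i"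
    "\<And>j. j < n \<Longrightarrow> c j = c' j" "\<And>j. j < n \<Longrightarrow> z j = z' j"
  shows "lp_optimal n k A b c z \<longleftrightarrow> lp_optimal n k A' b' c' z'"
proof -
  have "lp_feasible n k A b z \<longleftrightarrow> lp_feasible n k A' b' z'"
    "\<And>w. lp_feasible n k A b w \<longleftrightarrow> lp_feasible n k A' b' w"
    using lp_feasible_cong assms(1,2,4) by blast+
  moreover have "(\<Sum>j<n. c j * z j) = (\<Sum>j<n. c' j * z' j)"
    "\<And>w. (\<Sum>j<n. c j * w j) = (\<Sum>j<n. c' j * w j)"
    using assms(3,4) by (auto intro: sum.cong)
  ultimately show ?thesis unfolding lp_optimal_def is_arg_max_def by simp
qed

section \<open>The program and its correctness\<close>

abbreviation regN :: nexp where "regN \<equiv> NVar ''N''"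
abbreviation regM :: nexp where "regM \<equiv> NVar ''m''"
abbreviation regR :: nexp where "regR \<equiv> NVar ''r''"
abbreviation regJ :: nexp where "regJ \<equiv> NVar ''j''"
abbreviation one :: nexp where "one \<equiv> NConst 1"
abbreviation entry :: "vname \<Rightarrow> nexp \<Rightarrow> rexp" where "entry v i \<equiv> RCell v i (NConst 0)"
abbreviation NEq :: "nexp \<Rightarrow> nexp \<Rightarrow> test" where
  "NEq e f \<equiv> TAnd (TNot (NLess e f)) (TNot (NLess f e))"
abbreviation twoN :: nexp where "twoN \<equiv> NAdd regN regN"
abbreviation fourN :: nexp where "fourN \<equiv> NAdd twoN twoN"

text \<open>
  Entry \<open>r\<close> belongs to road \<open>r + 1\<close>. The test replaces the cut-off at \<open>0\<close> in the load:
  the roads before \<open>m\<close> are those with smaller free-flow latency.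
\<close>

definition load_cell :: "vname \<Rightarrow> cell" where
  "load_cell hw =
    (let i = NAdd regR one;
         base = RDiv (RAdd (entry hw i) (RCell ''L'' (NConst 0) (NConst 0))) (entry ''vf'' i);
         gap = RDiv (RSub (RDiv (entry ''d'' regM) (entry ''vf'' regM))
                          (RDiv (entry ''d'' i) (entry ''vf'' i)))
                    (RMul (entry ''d'' i) (entry ''rhomax'' i))
     in Split (NLess i regM) (Leaf (RAdd base gap)) (Leaf base))"

abbreviation neg :: "rexp \<Rightarrow> rexp" where "neg e \<equiv> RSub (RConst 0) e"

definition matrix_cell :: cell where
  "matrix_cell =
    Split (NLess regR regN)
      (Split (NEq regJ regR) (Leaf (entry ''hl'' regR))
        (Split (NEq regJ (NAdd regN regR)) (Leaf (entry ''al'' regR)) (Leaf (RConst 0))))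
    (Split (NLess regR twoN)
      (Split (NEq (NAdd regJ regN) regR) (Leaf (neg (entry ''hl'' regJ)))
        (Split (NEq regJ regR) (Leaf (neg (entry ''al'' (NSub regJ regN)))) (Leaf (RConst 0))))
    (Split (NLess regR fourN)
      (Split (NEq (NAdd twoN regJ) regR) (Leaf (RConst (-1))) (Leaf (RConst 0)))
    (Split (NLess regR (NAdd fourN one))
      (Split (NLess regJ regN) (Leaf (RConst 1)) (Leaf (RConst 0)))
    (Split (NLess regR (NAdd fourN (NConst 2)))
      (Split (NLess regJ regN) (Leaf (RConst (-1))) (Leaf (RConst 0)))
    (Split (NLess regR (NAdd fourN (NConst 3)))
      (Split (NLess regJ regN) (Leaf (RConst 0)) (Leaf (RConst 1)))
      (Split (NLess regJ regN) (Leaf (RConst 0)) (Leaf (RConst (-1)))))))))"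

definition bound_cell :: cell where
  "bound_cell =
    Split (NLess regR regN) (Split (NLess regR regM) (Leaf (RConst 1)) (Leaf (RConst 0)))
    (Split (NLess regR twoN)
      (Split (NLess (NAdd regR one) (NAdd regN regM)) (Leaf (RConst (-1))) (Leaf (RConst 0)))
    (Split (NLess regR fourN) (Leaf (RConst 0))
    (Split (NLess regR (NAdd fourN one)) (Leaf (entry ''xbar'' (NConst 0)))
    (Split (NLess regR (NAdd fourN (NConst 2))) (Leaf (neg (entry ''xbar'' (NConst 0))))
    (Split (NLess regR (NAdd fourN (NConst 3))) (Leaf (entry ''ybar'' (NConst 0)))
      (Leaf (neg (entry ''ybar'' (NConst 0)))))))))"

definition objective_cell :: cell where
  "objective_cell =
    Split (NEq (NAdd regR one) regM) (Leaf (neg (entry ''hl'' regR)))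
    (Split (NEq (NAdd regR one) (NAdd regN regM)) (Leaf (neg (entry ''al'' (NSub regR regN))))
      (Leaf (RConst 0)))"

definition trial :: com where
  "trial =
    Seq (NAssign ''m'' (NAdd regM one))
    (Seq (fill ''hl'' regN one (load_cell ''hhv''))
    (Seq (fill ''al'' regN one (load_cell ''hav''))
    (Seq (fill ''A'' (NAdd fourN (NConst 4)) twoN matrix_cell)
    (Seq (fill ''b'' (NAdd fourN (NConst 4)) one bound_cell)
    (Seq (fill ''c'' twoN one objective_cell)
      (SolveLP twoN (NAdd fourN (NConst 4)) ''A'' ''b'' ''c'' ''z'' ''flag''))))))"

text \<open>
  Candidates are tried in increasing order, so the first success is the index sought by the first
  stage.
\<close>

definition search :: com where
  "search =
    Seq (NAssign ''m'' (NConst 0)) (Seq (NAssign ''flag'' (NConst 0))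
      (While (TAnd (NLess regM regN) (NLess (NVar ''flag'') one)) trial))"

text \<open>
  The arrays start at index \<open>0\<close>, which belongs to no road; there truncated subtraction makes the entry
  a copy of some entry of the solution.
\<close>

definition write_routing :: com where
  "write_routing =
    Seq (fill ''x'' (NAdd regN one) one (Leaf (entry ''z'' (NSub regR one))))
    (Seq (fill ''y'' (NAdd regN one) one (Leaf (entry ''z'' (NAdd regN (NSub regR one)))))
      (fill ''s'' (NAdd regN one) one
        (Split (NLess regR regM) (Leaf (RConst 1)) (Leaf (RConst 0)))))"

text \<open>
  Without demand every linear program is trivially solvable although there is no common delay, hence
  no longest equilibrium road; this case is separated first.
\<close>

definition rbne_program :: com where
  "rbne_program =
    Cond (RLess (RConst 0) (RAdd (entry ''xbar'' (NConst 0)) (entry ''ybar'' (NConst 0))))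
      (Seq search
        (Cond (NLess (NConst 0) (NVar ''flag'')) write_routing (NAssign ''m'' (NConst 0))))
      (NAssign ''m'' (NConst 0))"

definition trial_cost :: "nat \<Rightarrow> nat" where
  "trial_cost N =
    1 + (fill_cost (cell_cost (load_cell ''hhv'')) N 1
    + (fill_cost (cell_cost (load_cell ''hav'')) N 1
    + (fill_cost (cell_cost matrix_cell) (lp_rows N) (N + N)
    + (fill_cost (cell_cost bound_cell) (lp_rows N) 1
    + (fill_cost (cell_cost objective_cell) (N + N) 1
    + (1 + (N + N + lp_rows N) ^ 3))))))"

lemma input_store_framed:
  assumes "input_store G xb yb \<sigma>" "framed v \<sigma> \<tau>"
    "v \<notin> {''d'', ''vf'', ''rhomax'', ''hav'', ''hhv'', ''L'', ''xbar'', ''ybar''}"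
  shows "input_store G xb yb \<tau>"
proof -
  have "reals \<tau> u = reals \<sigma> u"
    if "u \<in> {''d'', ''vf'', ''rhomax'', ''hav'', ''hhv'', ''L'', ''xbar'', ''ybar''}" for u
  proof -
    have "u \<noteq> v" using that assms(3) by blast
    then show ?thesis using assms(2) unfolding framed_def by blast
  qed
  moreover have "nats \<tau> ''N'' = nats \<sigma> ''N''" using assms(2) unfolding framed_def by simp
  ultimately show ?thesis using assms(1) unfolding input_store_def by simp
qed

lemma framed_nats: "framed v \<sigma> \<tau> \<Longrightarrow> u \<noteq> ''r'' \<Longrightarrow> u \<noteq> ''j'' \<Longrightarrow> nats \<tau> u = nats \<sigma> u"
  and framed_reals: "framed v \<sigma> \<tau> \<Longrightarrow> u \<noteq> v \<Longrightarrow> reals \<tau> u = reals \<sigma> u"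
  by (auto simp: framed_def)

lemma runs_fill_load:
  assumes valid: "valid_network G" and inp: "input_store G xb yb \<sigma>" and v: "v \<in> {''hl'', ''al''}"
    and m: "nats \<sigma> ''m'' = m" "m \<in> {1..roads G}"
    and hw: "hw = ''hhv'' \<and> h = hw_hv G \<or> hw = ''hav'' \<and> h = hw_av G"
  shows "runs solve (fill v regN one (load_cell hw)) \<sigma>
    (fill_cost (cell_cost (load_cell hw)) (roads G) 1)
    (\<lambda>\<tau>. framed v \<sigma> \<tau> \<and> (\<forall>i<roads G. \<forall>j<1. reals \<tau> v i j = (h (Suc i) + veh_len G) / vfree G (Suc i)
     + max 0 (free_latency G m - free_latency G (Suc i)) / (len G (Suc i) * rho_max G (Suc i))))"
proof (rule runs_fill)
  fix \<tau> assume fr: "framed v \<sigma> \<tau>"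
  have inp': "input_store G xb yb \<tau>" using input_store_framed[OF inp fr] v by auto
  have m': "nats \<tau> ''m'' = m" using fr m(1) by (simp add: framed_def)
  show "nval \<tau> regN = roads G" "nval \<tau> one = 1" using inp' by (auto simp: input_store_def)
  assume r: "nats \<tau> ''r'' < roads G"
  define i where "i = Suc (nats \<tau> ''r'')"
  have r1: "nats \<tau> ''r'' + 1 = i" by (simp add: i_def)
  have i: "i \<in> {1..roads G}" using r by (simp add: i_def)
  have h: "reals \<tau> hw i 0 = h i" using hw inp' i unfolding input_store_def by auto
  have gap: "max 0 (free_latency G m - free_latency G i) =
      (if i < m then len G m / vfree G m - len G i / vfree G i else 0)"
    using free_latency_less_iff[OF valid i m(2)] by (auto simp: free_latency_def)
  have "cell_val \<tau> (load_cell hw) = (h i + veh_len G) / vfree G i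
     + max 0 (free_latency G m - free_latency G i) / (len G i * rho_max G i)"
    unfolding gap using inp' i m(2) m' h by (simp add: load_cell_def input_store_def Let_def r1)
  then show "cell_val \<tau> (load_cell hw) = (h (Suc (nats \<tau> ''r'')) + veh_len G) / vfree G (Suc (nats \<tau> ''r''))
     + max 0 (free_latency G m - free_latency G (Suc (nats \<tau> ''r'')))
       / (len G (Suc (nats \<tau> ''r'')) * rho_max G (Suc (nats \<tau> ''r'')))"
    unfolding i_def .
qed

lemma lp_step_cases:
  assumes solver: "correct_lp_solver solve"
    and A: "\<And>i j. i < k \<Longrightarrow> j < n \<Longrightarrow> reals \<sigma> A i j = A' i j"
    and b: "\<And>i. i < k \<Longrightarrow> reals \<sigma> b i 0 = b' i" and c: "\<And>j. j < n \<Longrightarrow> reals \<sigma> c j 0 = c' j"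
  obtains "\<not> (\<exists>w. lp_optimal n k A' b' c' w)" "lp_step solve n k A b c z flag \<sigma> = set_nat flag 0 \<sigma>"
  | w where "lp_optimal n k A' b' c' w"
    "lp_step solve n k A b c z flag \<sigma> = set_nat flag 1 (set_vector z n w \<sigma>)"
proof -
  have eq: "lp_optimal n k (reals \<sigma> A) (\<lambda>i. reals \<sigma> b i 0) (\<lambda>j. reals \<sigma> c j 0) w \<longleftrightarrow>
      lp_optimal n k A' b' c' w" for w
    by (rule lp_optimal_cong) (simp_all add: A b c)
  let ?r = "solve n k (reals \<sigma> A) (\<lambda>i. reals \<sigma> b i 0) (\<lambda>j. reals \<sigma> c j 0)"
  have *: "case ?r of
        None \<Rightarrow> \<not> (\<exists>z. lp_optimal n k A' b' c' z)
      | Some z \<Rightarrow> lp_optimal n k A' b' c' z"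
    using solver unfolding correct_lp_solver_def eq[symmetric] by blast
  show thesis
  proof (cases ?r)
    case None
    then show thesis using * that(1) by (simp add: lp_step_def)
  next
    case (Some w)
    then show thesis using * that(2) by (simp add: lp_step_def)
  qed
qed

text \<open>
  After each array is filled, all arrays filled before it are still in place; the predicates \<open>P1\<close>
  to \<open>P5\<close> accumulate them. In the end the solver's report decides feasibility, because a feasible
  program of this kind has an optimum.
\<close>

lemma runs_trial:
  assumes valid: "valid_network G" and solver: "correct_lp_solver solve"
    and inp: "input_store G xb yb \<sigma>" and m: "Suc (nats \<sigma> ''m'') = m" "m \<in> {1..roads G}"
  shows "runs solve trial \<sigma> (trial_cost (roads G))
    (\<lambda>\<tau>. input_store G xb yb \<tau> \<and> nats \<tau> ''m'' = m \<and>
      (if nats \<tau> ''flag'' = 0 then \<not> (\<exists>z. equil_lp_feasible G xb yb m z)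
       else equil_lp_optimal G xb yb m (\<lambda>j. reals \<tau> ''z'' j 0)))"
    (is "runs _ _ _ _ ?Q")
proof -
  let ?N = "roads G"
  let ?h = "human_row G m" and ?a = "av_row G m"
  define base where "base \<tau> \<longleftrightarrow> input_store G xb yb \<tau> \<and> nats \<tau> ''m'' = m" for \<tau>
  define P1 where "P1 \<tau> \<longleftrightarrow> base \<tau> \<and> (\<forall>i<?N. reals \<tau> ''hl'' i 0 = ?h i)" for \<tau>
  define P2 where "P2 \<tau> \<longleftrightarrow> P1 \<tau> \<and> (\<forall>i<?N. reals \<tau> ''al'' i 0 = ?a i)" for \<tau>
  define P3 where "P3 \<tau> \<longleftrightarrow> P2 \<tau> \<and> (\<forall>i<lp_rows ?N. \<forall>j<?N + ?N.
    reals \<tau> ''A'' i j = lp_matrix ?N ?h ?a i j)" for \<tau>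
  define P4 where "P4 \<tau> \<longleftrightarrow> P3 \<tau> \<and>
    (\<forall>i<lp_rows ?N. reals \<tau> ''b'' i 0 = lp_bound ?N m xb yb i)" for \<tau>
  define P5 where "P5 \<tau> \<longleftrightarrow> P4 \<tau> \<and>
    (\<forall>i<?N + ?N. reals \<tau> ''c'' i 0 = lp_objective ?N m ?h ?a i)" for \<tau>
  note P_defs = P5_def P4_def P3_def P2_def P1_def
  have base_framed: "base \<tau>" if "base \<rho>" "framed v \<rho> \<tau>"
    "v \<notin> {''d'', ''vf'', ''rhomax'', ''hav'', ''hhv'', ''L'', ''xbar'', ''ybar''}" for v \<rho> \<tau>
    using that input_store_framed[of G xb yb \<rho> v \<tau>] framed_nats[of v \<rho> \<tau> "''m''"]
    unfolding base_def by simp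
  have baseD: "nats \<tau> ''N'' = ?N" "nats \<tau> ''m'' = m" "reals \<tau> ''xbar'' 0 0 = xb"
    "reals \<tau> ''ybar'' 0 0 = yb" if "base \<tau>" for \<tau>
    using that unfolding base_def input_store_def by auto
  have s0: "runs solve (NAssign ''m'' (NAdd regM one)) \<sigma> 1 base"
    using inp m(1) by (intro runs_NAssign) (simp add: base_def input_store_def)
  have s1: "runs solve (fill ''hl'' regN one (load_cell ''hhv'')) \<rho>
      (fill_cost (cell_cost (load_cell ''hhv'')) ?N 1) P1" if \<rho>: "base \<rho>" for \<rho>
  proof (rule runs_weaken[OF runs_fill_load[where h = "hw_hv G", OF valid]])
    show "input_store G xb yb \<rho>" "nats \<rho> ''m'' = m" using \<rho> unfolding base_def by auto
  qed (use m base_framed[OF \<rho>] in \<open>auto simp: P1_def human_load_def\<close>)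
  have s2: "runs solve (fill ''al'' regN one (load_cell ''hav'')) \<rho>
      (fill_cost (cell_cost (load_cell ''hav'')) ?N 1) P2" if \<rho>: "P1 \<rho>" for \<rho>
  proof (rule runs_weaken[OF runs_fill_load[where h = "hw_av G", OF valid]])
    show "input_store G xb yb \<rho>" "nats \<rho> ''m'' = m" using \<rho> unfolding P_defs base_def by auto
  qed (use m \<rho> base_framed[of \<rho>] in \<open>auto simp: P_defs av_load_def framed_reals\<close>)
  have s3: "runs solve (fill ''A'' (NAdd fourN (NConst 4)) twoN matrix_cell) \<rho>
      (fill_cost (cell_cost matrix_cell) (lp_rows ?N) (?N + ?N)) P3" if \<rho>: "P2 \<rho>" for \<rho>
  proof (rule runs_weaken[OF runs_fill])
    fix \<tau> assume fr: "framed ''A'' \<rho> \<tau>"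
    have P: "P2 \<tau>" using \<rho> fr base_framed[of \<rho> "''A''" \<tau>] framed_reals[OF fr] unfolding P_defs by simp
    then have b: "base \<tau>" unfolding P_defs by simp
    show "nval \<tau> (NAdd fourN (NConst 4)) = lp_rows ?N" "nval \<tau> twoN = ?N + ?N"
      using baseD[OF b] by simp_all
    assume "nats \<tau> ''r'' < lp_rows ?N" "nats \<tau> ''j'' < ?N + ?N"
    then show "cell_val \<tau> matrix_cell = lp_matrix ?N ?h ?a (nats \<tau> ''r'') (nats \<tau> ''j'')"
      using P baseD[OF b] unfolding P_defs matrix_cell_def lp_matrix_def by auto
  qed (use \<rho> base_framed[of \<rho>] in \<open>auto simp: P_defs framed_reals\<close>)
  have s4: "runs solve (fill ''b'' (NAdd fourN (NConst 4)) one bound_cell) \<rho>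
      (fill_cost (cell_cost bound_cell) (lp_rows ?N) 1) P4" if \<rho>: "P3 \<rho>" for \<rho>
  proof (rule runs_weaken[OF runs_fill])
    fix \<tau> assume fr: "framed ''b'' \<rho> \<tau>"
    have b: "base \<tau>" using \<rho> fr base_framed[of \<rho> "''b''" \<tau>] unfolding P_defs by simp
    show "nval \<tau> (NAdd fourN (NConst 4)) = lp_rows ?N" "nval \<tau> one = 1"
      using baseD[OF b] by simp_all
    show "cell_val \<tau> bound_cell = lp_bound ?N m xb yb (nats \<tau> ''r'')"
      using baseD[OF b] unfolding bound_cell_def lp_bound_def by simp
  qed (use \<rho> base_framed[of \<rho>] in \<open>auto simp: P_defs framed_reals\<close>)
  have s5: "runs solve (fill ''c'' twoN one objective_cell) \<rho>
      (fill_cost (cell_cost objective_cell) (?N + ?N) 1) P5" if \<rho>: "P4 \<rho>" for \<rho>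
  proof (rule runs_weaken[OF runs_fill])
    fix \<tau> assume fr: "framed ''c'' \<rho> \<tau>"
    have P: "P2 \<tau>" using \<rho> fr base_framed[of \<rho> "''c''" \<tau>] framed_reals[OF fr] unfolding P_defs by simp
    then have b: "base \<tau>" unfolding P_defs by simp
    show "nval \<tau> twoN = ?N + ?N" "nval \<tau> one = 1"
      using baseD[OF b] by simp_all
    show "cell_val \<tau> objective_cell = lp_objective ?N m ?h ?a (nats \<tau> ''r'')"
      using P baseD[OF b] m(2) unfolding P_defs objective_cell_def lp_objective_def by auto
  qed (use \<rho> base_framed[of \<rho>] in \<open>auto simp: P_defs framed_reals\<close>)
  have s6: "runs solve (SolveLP twoN (NAdd fourN (NConst 4)) ''A'' ''b'' ''c'' ''z'' ''flag'') \<rho>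
      (1 + (?N + ?N + lp_rows ?N) ^ 3) ?Q" if \<rho>: "P5 \<rho>" for \<rho>
  proof -
    have b: "base \<rho>" using \<rho> unfolding P_defs by simp
    let ?\<tau> = "lp_step solve (?N + ?N) (lp_rows ?N) ''A'' ''b'' ''c'' ''z'' ''flag'' \<rho>"
    have "?Q ?\<tau>"
    proof (rule lp_step_cases[OF solver, where k = "lp_rows ?N" and n = "?N + ?N" and \<sigma> = \<rho>
          and A' = "lp_matrix ?N ?h ?a" and b' = "lp_bound ?N m xb yb"
          and c' = "lp_objective ?N m ?h ?a" and A = "''A''" and b = "''b''" and c = "''c''"
          and z = "''z''" and flag = "''flag''"])
      assume "\<not> (\<exists>w. lp_optimal (?N + ?N) (lp_rows ?N) (lp_matrix ?N ?h ?a)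
        (lp_bound ?N m xb yb) (lp_objective ?N m ?h ?a) w)"
      then have "\<not> (\<exists>z. equil_lp_feasible G xb yb m z)"
        using equil_lp_optimum_exists[OF valid m(2)] unfolding equil_lp_optimal_def by blast
      moreover assume "?\<tau> = set_nat ''flag'' 0 \<rho>"
      ultimately show ?thesis using b by (simp add: base_def input_store_def)
    next
      fix w
      assume w: "lp_optimal (?N + ?N) (lp_rows ?N) (lp_matrix ?N ?h ?a)
        (lp_bound ?N m xb yb) (lp_objective ?N m ?h ?a) w"
        and \<tau>: "?\<tau> = set_nat ''flag'' 1 (set_vector ''z'' (?N + ?N) w \<rho>)"
      have "reals ?\<tau> ''z'' j 0 = w j" if "j < ?N + ?N" for j
        using that \<tau> by (simp add: set_vector_def)
      then have "equil_lp_optimal G xb yb m (\<lambda>j. reals ?\<tau> ''z'' j 0)"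
        using w lp_optimal_cong[of "lp_rows ?N" "?N + ?N" "lp_matrix ?N ?h ?a" "lp_matrix ?N ?h ?a"
            "lp_bound ?N m xb yb" "lp_bound ?N m xb yb" "lp_objective ?N m ?h ?a"
            "lp_objective ?N m ?h ?a" "\<lambda>j. reals ?\<tau> ''z'' j 0" w]
        unfolding equil_lp_optimal_def by blast
      then show ?thesis using b \<tau> by (simp add: base_def input_store_def set_vector_def)
    qed (use \<rho> in \<open>auto simp: P_defs\<close>)
    moreover have sizes: "nval \<rho> twoN = ?N + ?N" "nval \<rho> (NAdd fourN (NConst 4)) = lp_rows ?N"
      using baseD[OF b] by simp_all
    ultimately show ?thesis
      by (intro runs_SolveLP[of ?Q solve \<rho> twoN "NAdd fourN (NConst 4)", unfolded sizes])
  qed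
  show ?thesis
    unfolding trial_def trial_cost_def
    by (rule runs_Seq[OF s0], rule runs_Seq[OF s1], assumption, rule runs_Seq[OF s2], assumption,
        rule runs_Seq[OF s3], assumption, rule runs_Seq[OF s4], assumption,
        rule runs_Seq[OF s5], assumption, rule s6)
qed

text \<open>
  The invariant of the search: as long as the flag is \<open>0\<close>, the current candidate has been ruled out
  like all earlier ones.
\<close>

definition searched :: "network \<Rightarrow> real \<Rightarrow> real \<Rightarrow> store \<Rightarrow> bool" where
  "searched G xb yb \<tau> \<longleftrightarrow> input_store G xb yb \<tau> \<and> nats \<tau> ''m'' \<le> roads G \<and>
    (\<forall>k\<in>{1..<nats \<tau> ''m''}. \<not> (\<exists>z. equil_lp_feasible G xb yb k z)) \<and>
    (if nats \<tau> ''flag'' = 0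
     then \<forall>k\<in>{1..nats \<tau> ''m''}. \<not> (\<exists>z. equil_lp_feasible G xb yb k z)
     else 1 \<le> nats \<tau> ''m'' \<and> equil_lp_optimal G xb yb (nats \<tau> ''m'') (\<lambda>j. reals \<tau> ''z'' j 0))"

lemma runs_search:
  assumes valid: "valid_network G" and solver: "correct_lp_solver solve"
    and inp: "input_store G xb yb \<sigma>"
  shows "runs solve search \<sigma> (3 + roads G * (1 + trial_cost (roads G)))
    (\<lambda>\<tau>. searched G xb yb \<tau> \<and> (nats \<tau> ''flag'' = 0 \<longrightarrow> nats \<tau> ''m'' = roads G))"
    (is "runs _ _ _ _ ?Q")
proof -
  let ?B = "trial_cost (roads G)"
  let ?w = "While (TAnd (NLess regM regN) (NLess (NVar ''flag'') one)) trial"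
  have loop: "runs solve ?w \<tau> (1 + k * (1 + ?B)) ?Q"
    if "searched G xb yb \<tau>" "roads G - nats \<tau> ''m'' \<le> k" for k \<tau>
    using that
  proof (induction k arbitrary: \<tau>)
    case 0
    then have "nats \<tau> ''m'' = roads G" "nats \<tau> ''N'' = roads G"
      unfolding searched_def input_store_def by auto
    then have "runs solve ?w \<tau> 1 ?Q" using 0 by (intro runs_While_done) auto
    then show ?case by simp
  next
    case (Suc k)
    have N: "nats \<tau> ''N'' = roads G" and inp: "input_store G xb yb \<tau>"
      using Suc.prems(1) unfolding searched_def input_store_def by auto
    show ?case
    proof (cases "nats \<tau> ''m'' < roads G \<and> nats \<tau> ''flag'' = 0")
      case False
      then have "runs solve ?w \<tau> 1 ?Q"
        using Suc.prems(1) N by (intro runs_While_done) (auto simp: searched_def)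
      then show ?thesis by (rule runs_weaken) auto
    next
      case True
      let ?m = "Suc (nats \<tau> ''m'')"
      have m: "?m \<in> {1..roads G}" using True by auto
      have none: "\<forall>k\<in>{1..<?m}. \<not> (\<exists>z. equil_lp_feasible G xb yb k z)"
        using Suc.prems(1) True unfolding searched_def by auto
      have "runs solve ?w \<tau> (1 + ?B + (1 + k * (1 + ?B))) ?Q"
      proof (rule runs_While_step[OF _ runs_trial[OF valid solver inp refl m]])
        show "tval \<tau> (TAnd (NLess regM regN) (NLess (NVar ''flag'') one))" using True N by simp
        fix \<rho>
        assume \<rho>: "input_store G xb yb \<rho> \<and> nats \<rho> ''m'' = ?m \<and>
          (if nats \<rho> ''flag'' = 0 then \<not> (\<exists>z. equil_lp_feasible G xb yb ?m z)
           else equil_lp_optimal G xb yb ?m (\<lambda>j. reals \<rho> ''z'' j 0))"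
        have "\<forall>k\<in>{1..?m}. \<not> (\<exists>z. equil_lp_feasible G xb yb k z)" if "nats \<rho> ''flag'' = 0"
          using \<rho> none that by (auto simp: le_Suc_eq less_Suc_eq_le)
        then have "searched G xb yb \<rho>" unfolding searched_def using \<rho> m none by auto
        then show "runs solve ?w \<rho> (1 + k * (1 + ?B)) ?Q"
          using Suc.prems(2) \<rho> True by (intro Suc.IH) auto
      qed
      then show ?thesis by (rule runs_weaken) auto
    qed
  qed
  have "runs solve search \<sigma> (1 + (1 + (1 + roads G * (1 + ?B)))) ?Q"
    unfolding search_def
  proof (rule runs_Seq)
    show "runs solve (NAssign ''m'' (NConst 0)) \<sigma> 1
        (\<lambda>\<tau>. input_store G xb yb \<tau> \<and> nats \<tau> ''m'' = 0)"
      using inp by (intro runs_NAssign) (simp add: input_store_def)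
    fix \<tau> assume \<tau>: "input_store G xb yb \<tau> \<and> nats \<tau> ''m'' = 0"
    show "runs solve (Seq (NAssign ''flag'' (NConst 0)) ?w) \<tau> (1 + (1 + roads G * (1 + ?B))) ?Q"
    proof (rule runs_Seq)
      show "runs solve (NAssign ''flag'' (NConst 0)) \<tau> 1
          (\<lambda>\<tau>. searched G xb yb \<tau> \<and> nats \<tau> ''m'' = 0)"
        using \<tau> by (intro runs_NAssign) (simp add: searched_def input_store_def)
    qed (use loop in auto)
  qed
  then show ?thesis by (rule runs_weaken) auto
qed

definition write_cost :: "nat \<Rightarrow> nat" where
  "write_cost N = fill_cost 1 (N + 1) 1 + (fill_cost 1 (N + 1) 1 + fill_cost 2 (N + 1) 1)"

lemma runs_write_routing:
  assumes N: "nats \<sigma> ''N'' = N"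
  defines "z \<equiv> \<lambda>j. reals \<sigma> ''z'' j 0"
  shows "runs solve write_routing \<sigma> (write_cost N) (\<lambda>\<tau>. nats \<tau> ''m'' = nats \<sigma> ''m'' \<and>
    (\<forall>i\<in>{1..N}. reals \<tau> ''x'' i 0 = z (i - 1) \<and> reals \<tau> ''y'' i 0 = z (N + (i - 1)) \<and>
      reals \<tau> ''s'' i 0 = of_bool (i < nats \<sigma> ''m'')))" (is "runs _ _ _ _ ?Q")
proof -
  define kept where "kept \<tau> \<longleftrightarrow> nats \<tau> ''N'' = N \<and> nats \<tau> ''m'' = nats \<sigma> ''m'' \<and>
    reals \<tau> ''z'' = reals \<sigma> ''z''" for \<tau> :: store
  have kept_framed: "kept \<tau>" if "kept \<rho>" "framed v \<rho> \<tau>" "v \<noteq> ''z''" for v \<rho> \<tau>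
    using that unfolding kept_def framed_def by auto
  define P1 where "P1 \<tau> \<longleftrightarrow> kept \<tau> \<and> (\<forall>i<N + 1. reals \<tau> ''x'' i 0 = z (i - 1))" for \<tau>
  define P2 where "P2 \<tau> \<longleftrightarrow> P1 \<tau> \<and> (\<forall>i<N + 1. reals \<tau> ''y'' i 0 = z (N + (i - 1)))" for \<tau>
  have s1: "runs solve (fill ''x'' (NAdd regN one) one (Leaf (entry ''z'' (NSub regR one)))) \<sigma>
      (fill_cost 1 (N + 1) 1) P1"
  proof -
    have k: "kept \<tau>" if "framed ''x'' \<sigma> \<tau>" for \<tau>
      using kept_framed[of \<sigma>] that N by (simp add: kept_def)
    have "runs solve (fill ''x'' (NAdd regN one) one (Leaf (entry ''z'' (NSub regR one)))) \<sigma>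
      (fill_cost (cell_cost (Leaf (entry ''z'' (NSub regR one)))) (N + 1) 1)
      (\<lambda>\<tau>. framed ''x'' \<sigma> \<tau> \<and> (\<forall>i<N + 1. \<forall>j<1. reals \<tau> ''x'' i j = z (i - 1)))"
      by (rule runs_fill) (use k in \<open>auto simp: kept_def z_def\<close>)
    then show ?thesis by (rule runs_weaken) (use k in \<open>auto simp: P1_def\<close>)
  qed
  have s2: "runs solve (fill ''y'' (NAdd regN one) one (Leaf (entry ''z'' (NAdd regN (NSub regR one))))) \<rho>
      (fill_cost 1 (N + 1) 1) P2" if \<rho>: "P1 \<rho>" for \<rho>
  proof -
    have k: "kept \<tau>" if "framed ''y'' \<rho> \<tau>" for \<tau>
      using kept_framed[of \<rho>] that \<rho> by (simp add: P1_def)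
    have "runs solve (fill ''y'' (NAdd regN one) one (Leaf (entry ''z'' (NAdd regN (NSub regR one))))) \<rho>
      (fill_cost (cell_cost (Leaf (entry ''z'' (NAdd regN (NSub regR one))))) (N + 1) 1)
      (\<lambda>\<tau>. framed ''y'' \<rho> \<tau> \<and> (\<forall>i<N + 1. \<forall>j<1. reals \<tau> ''y'' i j = z (N + (i - 1))))"
      by (rule runs_fill) (use k in \<open>auto simp: kept_def z_def\<close>)
    then show ?thesis
      by (rule runs_weaken) (use k \<rho> in \<open>auto simp: P1_def P2_def framed_reals\<close>)
  qed
  have s3: "runs solve (fill ''s'' (NAdd regN one) one
        (Split (NLess regR regM) (Leaf (RConst 1)) (Leaf (RConst 0)))) \<rho>
      (fill_cost 2 (N + 1) 1) ?Q" if \<rho>: "P2 \<rho>" for \<rho>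
  proof -
    have k: "kept \<tau>" if "framed ''s'' \<rho> \<tau>" for \<tau>
      using kept_framed[of \<rho>] that \<rho> by (simp add: P1_def P2_def)
    have "runs solve (fill ''s'' (NAdd regN one) one
        (Split (NLess regR regM) (Leaf (RConst 1)) (Leaf (RConst 0)))) \<rho>
      (fill_cost (cell_cost (Split (NLess regR regM) (Leaf (RConst 1)) (Leaf (RConst 0)))) (N + 1) 1)
      (\<lambda>\<tau>. framed ''s'' \<rho> \<tau> \<and> (\<forall>i<N + 1. \<forall>j<1. reals \<tau> ''s'' i j = of_bool (i < nats \<sigma> ''m'')))"
      by (rule runs_fill) (use k in \<open>auto simp: kept_def\<close>)
    then show ?thesis
      by (rule runs_weaken) (use k \<rho> in \<open>auto simp: kept_def P1_def P2_def framed_reals\<close>)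
  qed
  show ?thesis
    unfolding write_routing_def write_cost_def
    by (rule runs_Seq[OF s1], rule runs_Seq[OF s2], assumption, rule s3)
qed

text \<open>
  An equilibrium with longest road \<open>i\<close> need not solve the program of road \<open>i\<close>, as its delay may
  exceed \<open>free_latency G i\<close>; but then some road up to \<open>i\<close> has a feasible program.
\<close>

lemma no_equil_lp_no_NE:
  assumes valid: "valid_network G" and demand: "xb + yb > 0"
    and none: "\<forall>k\<in>{1..n}. \<not> (\<exists>z. equil_lp_feasible G xb yb k z)" and i: "i \<le> n"
  shows "NE G xb yb i = {}"
proof (rule ccontr)
  assume "NE G xb yb i \<noteq> {}"
  then obtain r where r: "r \<in> NE G xb yb i" by blast
  obtain k x y s where k: "k \<in> {1..i}" and E: "equil G xb yb (free_latency G k) x y s"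
    using NE_nonempty_equil[OF valid demand r] by blast
  have "k \<in> {1..roads G}" using k NE_road[OF valid demand r] by auto
  then show False using equil_lp_feasible_of_equil[OF valid _ E] none k i by force
qed

definition rbne_cost :: "nat \<Rightarrow> nat" where
  "rbne_cost N = 5 + N * (1 + trial_cost N) + write_cost N"

lemma runs_rbne_program:
  assumes valid: "valid_network G" and nn: "xb \<ge> 0" "yb \<ge> 0" and solver: "correct_lp_solver solve"
    and inp: "input_store G xb yb \<sigma>"
  shows "runs solve rbne_program \<sigma> (rbne_cost (roads G)) (output_store G xb yb)"
proof -
  let ?S = "3 + roads G * (1 + trial_cost (roads G))" and ?W = "write_cost (roads G)"
  have "runs solve rbne_program \<sigma> (1 + (?S + (1 + ?W))) (output_store G xb yb)"
    unfolding rbne_program_def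
  proof (rule runs_Cond)
    assume "\<not> tval \<sigma> (RLess (RConst 0) (RAdd (entry ''xbar'' (NConst 0)) (entry ''ybar'' (NConst 0))))"
    then have "\<not> xb + yb > 0" using inp by (simp add: input_store_def)
    then have "two_stage G xb yb = {}"
      using two_stage_empty_if_no_NE zero_demand_no_NE[OF nn] by blast
    then have "runs solve (NAssign ''m'' (NConst 0)) \<sigma> 1 (output_store G xb yb)"
      by (intro runs_NAssign) (simp add: output_store_def)
    then show "runs solve (NAssign ''m'' (NConst 0)) \<sigma> (?S + (1 + ?W)) (output_store G xb yb)"
      by (rule runs_weaken) auto
  next
    assume "tval \<sigma> (RLess (RConst 0) (RAdd (entry ''xbar'' (NConst 0)) (entry ''ybar'' (NConst 0))))"
    then have demand: "xb + yb > 0" using inp by (simp add: input_store_def)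
    show "runs solve (Seq search
        (Cond (NLess (NConst 0) (NVar ''flag'')) write_routing (NAssign ''m'' (NConst 0)))) \<sigma>
      (?S + (1 + ?W)) (output_store G xb yb)"
    proof (rule runs_Seq[OF runs_search[OF valid solver inp]], rule runs_Cond)
      fix \<tau>
      assume \<tau>: "searched G xb yb \<tau> \<and> (nats \<tau> ''flag'' = 0 \<longrightarrow> nats \<tau> ''m'' = roads G)"
        and "\<not> tval \<tau> (NLess (NConst 0) (NVar ''flag''))"
      then have none: "\<forall>k\<in>{1..roads G}. \<not> (\<exists>z. equil_lp_feasible G xb yb k z)"
        unfolding searched_def by auto
      have "NE G xb yb m = {}" for m
      proof (cases "m \<le> roads G")
        case True
        then show ?thesis using no_equil_lp_no_NE[OF valid demand none] by blast
      next
        case False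
        then show ?thesis using NE_road[OF valid demand, of _ m] by auto
      qed
      then have "two_stage G xb yb = {}" by (rule two_stage_empty_if_no_NE)
      then have "runs solve (NAssign ''m'' (NConst 0)) \<tau> 1 (output_store G xb yb)"
        by (intro runs_NAssign) (simp add: output_store_def)
      then show "runs solve (NAssign ''m'' (NConst 0)) \<tau> ?W (output_store G xb yb)"
        by (rule runs_weaken) (auto simp: write_cost_def fill_cost_def)
    next
      fix \<tau>
      assume \<tau>: "searched G xb yb \<tau> \<and> (nats \<tau> ''flag'' = 0 \<longrightarrow> nats \<tau> ''m'' = roads G)"
        and "tval \<tau> (NLess (NConst 0) (NVar ''flag''))"
      define m where "m = nats \<tau> ''m''"
      define z where "z = (\<lambda>j. reals \<tau> ''z'' j 0)"
      have N: "nats \<tau> ''N'' = roads G" and m: "m \<in> {1..roads G}"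
        and none: "\<forall>k\<in>{1..m - 1}. \<not> (\<exists>z. equil_lp_feasible G xb yb k z)"
        and opt: "equil_lp_optimal G xb yb m z"
        using \<tau> \<open>tval \<tau> _\<close> unfolding searched_def input_store_def m_def z_def by auto
      have "equil_lp_feasible G xb yb m z"
        using opt unfolding equil_lp_optimal_def equil_lp_feasible_def lp_optimal_def is_arg_max_def
        by blast
      then have "NE G xb yb m \<noteq> {}"
        using equil_lp_feasible_iff[OF valid m] equil_at_free_latency_NE[OF valid demand _ m]
        by blast
      moreover have "NE G xb yb k = {}" if "k < m" for k
        using no_equil_lp_no_NE[OF valid demand none] that by simp
      ultimately have mEQ: "m_EQ G xb yb m" unfolding m_EQ_iff[OF valid demand] by blast
      show "runs solve write_routing \<tau> ?W (output_store G xb yb)"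
      proof (rule runs_weaken[OF runs_write_routing[OF N]])
        fix \<rho> :: store
        assume *: "nats \<rho> ''m'' = nats \<tau> ''m'' \<and>
          (\<forall>i\<in>{1..roads G}. reals \<rho> ''x'' i 0 = reals \<tau> ''z'' (i - 1) 0 \<and>
            reals \<rho> ''y'' i 0 = reals \<tau> ''z'' (roads G + (i - 1)) 0 \<and>
            reals \<rho> ''s'' i 0 = of_bool (i < nats \<tau> ''m''))"
        have best: "is_arg_max (robustness G xb yb m) (\<lambda>r. r \<in> NE G xb yb m)
            (\<lambda>i. reals \<rho> ''x'' i 0, \<lambda>i. reals \<rho> ''y'' i 0, \<lambda>i. i < m)"
          using * by (intro equil_lp_optimal_imp_robust[OF valid demand nn mEQ opt]) (simp add: z_def)
        then have "two_stage G xb yb \<noteq> {}" using mEQ unfolding two_stage_def by blast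
        then show "output_store G xb yb \<rho>"
          using best mEQ * unfolding output_store_def m_def by auto
      qed simp
    qed
  qed
  then show ?thesis by (rule runs_weaken) (simp add: rbne_cost_def)
qed

text \<open>
  Each of the at most \<open>N\<close> trials costs \<open>O(N\<^sup>2)\<close> for writing the matrix and \<open>O(N\<^sup>3)\<close> for
  the solver, with \<open>6 N + 4\<close> variables and constraints in total.
\<close>

lemma rbne_cost_bigo: "(\<lambda>N. real (rbne_cost N)) \<in> O(\<lambda>N. real N ^ 4)"
  unfolding rbne_cost_def write_cost_def trial_cost_def fill_cost_def
  by (simp add: load_cell_def matrix_cell_def bound_cell_def objective_cell_def Let_def) real_asymp

theorem theorem3:
  shows "(\<forall>G xb yb. valid_network G \<and> xb \<ge> 0 \<and> yb \<ge> 0 \<longrightarrow>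
            two_stage G xb yb = RBNE G xb yb) \<and>
         (\<exists>p. \<exists>T :: nat \<Rightarrow> real. T \<in> O(\<lambda>N. real N ^ 4) \<and>
            (\<forall>solve G xb yb \<sigma>.
               correct_lp_solver solve \<and> valid_network G \<and> xb \<ge> 0 \<and> yb \<ge> 0 \<and>
               input_store G xb yb \<sigma> \<longrightarrow>
               (\<exists>t \<tau>. exec solve p \<sigma> t \<tau> \<and> real t \<le> T (roads G) \<and>
                      output_store G xb yb \<tau>)))"
proof (intro conjI allI impI)
  show "two_stage G xb yb = RBNE G xb yb" if "valid_network G \<and> xb \<ge> 0 \<and> yb \<ge> 0" for G xb yb
    using that two_stage_eq_RBNE by blast
  show "\<exists>p. \<exists>T :: nat \<Rightarrow> real. T \<in> O(\<lambda>N. real N ^ 4) \<and>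
            (\<forall>solve G xb yb \<sigma>.
               correct_lp_solver solve \<and> valid_network G \<and> xb \<ge> 0 \<and> yb \<ge> 0 \<and>
               input_store G xb yb \<sigma> \<longrightarrow>
               (\<exists>t \<tau>. exec solve p \<sigma> t \<tau> \<and> real t \<le> T (roads G) \<and>
                      output_store G xb yb \<tau>))"
    using rbne_cost_bigo runs_rbne_program unfolding runs_def
    by (intro exI[of _ rbne_program] exI[of _ "\<lambda>N. real (rbne_cost N)"])
      (metis of_nat_le_iff)
qed

end
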